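(* Let $n\ge1$ be an integer, $\alpha=2$ and $\nu>0$, and let $r>0$. I. If $\frac n2-\nu$ is not an integer, then $$q_{2,\nu,n}(r)=\frac{1}{2^n\pi^{\frac{n-2}{2}}\Gamma(\nu)\sin\left[\pi\left(\frac n2-\nu\right)\right]}\sum_{j=0}^\infty\left(\frac{(r/2)^{2j+2\nu-n}}{j!\,\Gamma\left(j+\nu-\frac{n-2}{2}\right)}-\frac{(r/2)^{2j}}{j!\,\Gamma\left(j+\frac{n+2}{2}-\nu\right)}\right).$$ II. If $\frac n2-\nu=l$ is an integer, then $$q_{2,\nu,n}(r)=\frac{1}{2^n\pi^{\frac n2}\Gamma\left(\frac n2-l\right)}\Biggl(\sum_{j=0}^{|l|-1}(-1)^j\frac{(|l|-j-1)!}{j!}\left(\frac r2\right)^{2j-|l|-l}+(-1)^{l+1}\sum_{j=0}^\infty\frac{(r/2)^{|l|-l+2j}}{j!\,(|l|+j)!}\left[2\log\frac r2-\psi(j+1)-\psi(|l|+j+1)\right]\Biggr).$$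
   Context: $\Vert\cdot\Vert$ is the Euclidean norm on $\mathbb{R}^n$. For an integer $n\ge1$, $\alpha\in(0,2]$, $\nu>0$, $p_{\alpha,\nu,n}$ denotes the probability density function on $\mathbb{R}^n$ whose characteristic function is $\int_{\mathbb{R}^n}e^{i\mathbf{x}\cdot\boldsymbol{t}}p_{\alpha,\nu,n}(\mathbf{x})\,d^n\mathbf{x}=(1+\Vert\boldsymbol{t}\Vert^\alpha)^{-\nu}$ for all $\boldsymbol{t}\in\mathbb{R}^n$. It is a radial function; one takes the version which is continuous on $\mathbb{R}^n\setminus\{\mathbf{0}\}$, and $q_{\alpha,\nu,n}(r)$, $r>0$, denotes the value of $p_{\alpha,\nu,n}(\mathbf{x})$ at points with $\Vert\mathbf{x}\Vert=r$. $\psi=\Gamma'/\Gamma$ is the digamma function. Empty sums are zero. *)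

theory Defs
  imports "HOL-Probability.Probability"
begin

text \<open>The dimension \<open>n\<close> is \<open>CARD('n)\<close> throughout. Nonnegativity and continuity are imposed pointwise,
  so the characteristic function determines the density everywhere except at the origin, where its value plays no role.\<close>

definition is_linnik_density :: "real \<Rightarrow> real \<Rightarrow> (real ^ 'n::finite \<Rightarrow> real) \<Rightarrow> bool" where
  "is_linnik_density \<alpha> \<nu> p \<longleftrightarrow>
     p \<in> borel_measurable borel \<and> (\<forall>x. 0 \<le> p x) \<and>
     prob_space (density lborel (\<lambda>x. ennreal (p x))) \<and>
     (\<forall>t. (\<integral>x. exp (\<i> * complex_of_real (x \<bullet> t)) * complex_of_real (p x) \<partial>lborel)
            = complex_of_real ((1 + norm t powr \<alpha>) powr (- \<nu>))) \<and>
     continuous_on (UNIV - {0}) p"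

definition linnik_density :: "real \<Rightarrow> real \<Rightarrow> real ^ 'n::finite \<Rightarrow> real" where
  "linnik_density \<alpha> \<nu> = (SOME p. is_linnik_density \<alpha> \<nu> p)"

text \<open>The radial profile \<open>q\<close>: the common value of the density on the sphere of radius \<open>r\<close>.
  Radiality is not built into the density; the description below is proper only because it holds.
  The type argument carries the dimension.\<close>

definition linnik_radial :: "'n::finite itself \<Rightarrow> real \<Rightarrow> real \<Rightarrow> real \<Rightarrow> real" where
  "linnik_radial _ \<alpha> \<nu> r =
     (THE y. \<forall>x :: real ^ 'n. norm x = r \<longrightarrow> linnik_density \<alpha> \<nu> x = y)"

end

theory Submission
  imports Defs "HOL-Complex_Analysis.Complex_Analysis"
begin

text \<open>Writing \<open>(1 + \<bar>t\<bar>\<^sup>2) powr (- \<nu>)\<close> as a Gamma-weighted integral of \<open>exp (- s \<bar>t\<bar>\<^sup>2)\<close> exhibits the density as a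
  Gamma mixture of heat kernels, hence as a Bessel integral \<open>F(\<mu>, x) = \<integral> s powr (- \<mu> - 1) exp (- s - x / s) ds\<close> with
  \<open>\<mu> = n/2 - \<nu>\<close> and \<open>x = (r/2)\<^sup>2\<close>. Two densities with the same characteristic function agree at every common point of
  continuity, because their Gaussian smoothings agree. For \<open>\<mu> \<notin> \<int>\<close> both \<open>F\<close> and the series expression satisfy
  \<open>\<partial>\<^sub>x F(\<mu>) = - F(\<mu> + 1)\<close> and \<open>F(- \<mu>, x) = x powr \<mu> F(\<mu>, x)\<close> with the same limits at \<open>0\<close> for \<open>- 1 < \<mu> < 0\<close>, and these
  properties have only one solution. The integer case follows by letting \<open>\<mu>\<close> tend to the integer: \<open>F\<close> is convex, hence
  continuous, in \<open>\<mu>\<close>, and the series can be differentiated termwise in \<open>\<mu>\<close>.\<close>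

section \<open>The Bessel integral\<close>

text \<open>Comparison after Gaussian smoothing works for all \<nu> and at one point at a time. The
  series cannot be read off by expanding \<open>exp (- x / s)\<close> under the integral, since the
  terms with large j diverge at s = 0. Hence the detour through a characterisation. The range -1 <
  \<mu> < 0 is the one in which an index -a and its partner a - 1 both have finite limits at x = 0
  and form a closed first-order system; differentiation and reflection then reach every other
  noninteger index. At an integer \<mu> the two series become proportional and the sine in the
  denominator vanishes, so the formula turns into a derivative in \<mu>. Coefficients with
  \<open>rGamma\<close> stay meaningful there: the zeros of 1/Gamma make the numerator vanish, and
  its derivatives at those zeros are the factorials of the finite sum.\<close>

lemma set_integrable_exp_powr:
  fixes a :: real
  assumes "a > 0"
  shows "set_integrable lborel {0<..} (\<lambda>s. s powr (a - 1) * exp (- s))"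
    and "(LINT s:{0<..}|lborel. s powr (a - 1) * exp (- s)) = Gamma a"
proof -
  have hi: "((\<lambda>s. s powr (a - 1) * exp (- s)) has_integral Gamma a) {0..}"
    using Gamma_integral_real[OF assms] by (simp add: exp_minus field_simps)
  have hi': "((\<lambda>s. s powr (a - 1) * exp (- s)) has_integral Gamma a) {0<..}"
  proof (rule has_integral_spike_set_eq[THEN iffD1, rotated 2])
    show "((\<lambda>s. s powr (a - 1) * exp (- s)) has_integral Gamma a) {0..}" by (rule hi)
    show "negligible {s \<in> {0..} - {0<..}. s powr (a - 1) * exp (- s) \<noteq> 0}"
      by (rule negligible_subset[of "{0}"]) auto
    have "{s \<in> {0<..} - {0..}. s powr (a - 1) * exp (- s) \<noteq> 0} = {}" by auto
    then show "negligible {s \<in> {0<..} - {0..}. s powr (a - 1) * exp (- s) \<noteq> 0}" by (simp only: negligible_empty)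
  qed
  have "(\<lambda>s. s powr (a - 1) * exp (- s)) absolutely_integrable_on {0<..}"
    using hi' by (intro nonnegative_absolutely_integrable_1) (auto simp: has_integral_integrable)
  then have 1: "set_integrable lebesgue {0<..} (\<lambda>s. s powr (a - 1) * exp (- s))" .
  show 2: "set_integrable lborel {0<..} (\<lambda>s. s powr (a - 1) * exp (- s))"
    using 1 unfolding set_integrable_def by (subst (asm) integrable_completion) auto
  show "(LINT s:{0<..}|lborel. s powr (a - 1) * exp (- s)) = Gamma a"
    using set_borel_integral_eq_integral(2)[OF 2] integral_unique[OF hi'] by simp
qed

text \<open>This is \<open>2 x powr (- \<mu>/2) K\<^sub>\<mu>(2 \<surd>x)\<close>, with \<open>K\<^sub>\<mu>\<close> the modified Bessel function of the second kind.\<close>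

definition bessel_integral :: "real \<Rightarrow> real \<Rightarrow> real" where
  "bessel_integral \<mu> x = (LINT s:{0<..}|lborel. s powr (- \<mu> - 1) * exp (- s - x / s))"

lemma exp_minus_le_inverse_power:
  fixes y :: real
  assumes "y > 0"
  shows "exp (- y) \<le> fact k / y ^ k"
proof -
  have "y ^ k / fact k \<le> exp y"
  proof -
    have "(\<Sum>n\<in>{k}. y ^ n /\<^sub>R fact n) \<le> (\<Sum>n. y ^ n /\<^sub>R fact n)"
      using assms summable_exp_generic[of y] by (intro sum_le_suminf) auto
    then show ?thesis by (simp add: exp_def divide_inverse mult.commute)
  qed
  then show ?thesis
    using assms by (simp add: exp_minus field_simps)
qed

text \<open>Near 0 the factor \<open>exp (- x / s)\<close> beats every power of 1/s: one term of the
  exponential series trades it for a multiple of \<open>s ^ k\<close>, and k > \<mu> leaves the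
  integrand of a convergent Gamma integral.\<close>

lemma set_integrable_bessel:
  fixes x :: real
  assumes "x > 0"
  shows "set_integrable lborel {0<..} (\<lambda>s. s powr (- \<mu> - 1) * exp (- s - x / s))"
proof -
  obtain k :: nat where k: "real k > \<mu>" using reals_Archimedean2 by blast
  have *: "s powr (- \<mu> - 1) * exp (- s - x / s)
      \<le> fact k / x ^ k * (s powr ((real k - \<mu>) - 1) * exp (- s))" if "s > 0" for s
  proof -
    have "exp (- (x / s)) \<le> fact k / (x / s) ^ k"
      using assms that by (intro exp_minus_le_inverse_power) auto
    also have "\<dots> = fact k / x ^ k * s powr real k"
      using that by (simp add: power_divide powr_realpow)
    finally have "s powr (- \<mu> - 1) * exp (- s) * exp (- (x / s))
      \<le> s powr (- \<mu> - 1) * exp (- s) * (fact k / x ^ k * s powr real k)"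
      by (intro mult_left_mono) auto
    moreover have "s powr (- \<mu> - 1) * s powr real k = s powr ((real k - \<mu>) - 1)"
      by (simp add: algebra_simps flip: powr_add)
    ultimately show ?thesis
      by (simp add: exp_diff exp_minus field_simps)
  qed
  show ?thesis
  proof (rule set_integrable_bound)
    show "set_integrable lborel {0<..} (\<lambda>s. fact k / x ^ k * (s powr ((real k - \<mu>) - 1) * exp (- s)))"
      using k set_integrable_exp_powr(1)[of "real k - \<mu>"] by simp
    show "AE s in lborel. s \<in> {0<..} \<longrightarrow> norm (s powr (- \<mu> - 1) * exp (- s - x / s))
        \<le> norm (fact k / x ^ k * (s powr ((real k - \<mu>) - 1) * exp (- s)))"
      using * assms by (intro AE_I2 impI) (auto simp: abs_mult)
  qed (simp add: set_borel_measurable_def)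
qed

lemma exp_remainder_bound: "\<bar>exp y - 1 - y\<bar> \<le> exp \<bar>y\<bar> * y\<^sup>2" for y :: real
proof -
  have "(\<Sum>i\<le>1. y ^ i / fact i) = 1 + y" by simp
  then show ?thesis
    using Taylor_exp_field[of y 1] by (simp add: numeral_2_eq_2 diff_diff_eq)
qed

text \<open>Differentiation under the integral sign with an explicit error: the linear term of
  \<open>exp (- h / s)\<close> brings a factor 1/s, which raises the index by one, and the remainder
  is quadratic in h.\<close>

lemma bessel_integral_has_derivative:
  assumes x: "x > 0"
  shows "(bessel_integral \<mu> has_real_derivative - bessel_integral (\<mu> + 1) x) (at x)"
proof -
  \<comment> \<open>The remainder carries 1/s twice, hence the index \<mu> + 2. Its factor
    \<open>exp (\<bar>h\<bar> / s)\<close> is absorbed by half of \<open>exp (- x / s)\<close>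
    because |h| < x/2, hence the argument x/2.\<close>
  let ?C = "bessel_integral (\<mu> + 2) (x / 2)"
  have bd: "\<bar>(bessel_integral \<mu> (x + h) - bessel_integral \<mu> x) / h - (- bessel_integral (\<mu> + 1) x)\<bar> \<le> \<bar>h\<bar> * ?C"
    if h: "\<bar>h\<bar> < x / 2" "h \<noteq> 0" for h
  proof -
    have xh: "x + h > 0" using h by linarith
    have I: "set_integrable lborel {0<..} (\<lambda>s. s powr (- \<mu> - 1) * exp (- s - (x + h) / s))"
      "set_integrable lborel {0<..} (\<lambda>s. s powr (- \<mu> - 1) * exp (- s - x / s))"
      "set_integrable lborel {0<..} (\<lambda>s. h * (s powr (- (\<mu> + 1) - 1) * exp (- s - x / s)))"
      by (rule set_integrable_bessel[OF xh] set_integrable_bessel[OF x]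
          set_integrable_mult_right[OF set_integrable_bessel[OF x]])+
    let ?d = "\<lambda>s. (s powr (- \<mu> - 1) * exp (- s - (x + h) / s) - s powr (- \<mu> - 1) * exp (- s - x / s))
            + h * (s powr (- (\<mu> + 1) - 1) * exp (- s - x / s))"
    have eq: "bessel_integral \<mu> (x + h) - bessel_integral \<mu> x + h * bessel_integral (\<mu> + 1) x
        = (LINT s:{0<..}|lborel. ?d s)"
      unfolding bessel_integral_def
      by (simp only: set_integral_add(2)[OF set_integral_diff(1)[OF I(1,2)] I(3)]
          set_integral_diff(2)[OF I(1,2)] set_integral_mult_right)
    have Id: "set_integrable lborel {0<..} ?d"
      by (rule set_integral_add(1)[OF set_integral_diff(1)[OF I(1,2)] I(3)])
    have pw: "\<bar>?d s\<bar> \<le> h\<^sup>2 * (s powr (- (\<mu> + 2) - 1) * exp (- s - (x / 2) / s))" if s: "s > 0" for s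
    proof -
      have e1: "exp (- s - (x + h) / s) = exp (- s) * exp (- x / s) * exp (- h / s)"
        by (simp add: add_divide_distrib flip: exp_add)
      have p1: "s powr (- (\<mu> + 1) - 1) = s powr (- \<mu> - 1) * inverse s"
        using s by (simp add: powr_diff powr_minus field_simps powr_add power2_eq_square)
      have p2: "s powr (- (\<mu> + 2) - 1) = s powr (- \<mu> - 1) * inverse (s\<^sup>2)"
      proof -
        have "s powr (- (\<mu> + 2) - 1) = s powr (- \<mu> - 1) * s powr (- 2)"
          by (simp add: algebra_simps flip: powr_add)
        then show ?thesis using s by (simp add: powr_minus)
      qed
      have e2: "exp (- s - x / s) = exp (- s) * exp (- x / s)"
        by (simp flip: exp_add)
      have e3: "exp (- s - (x / 2) / s) = exp (- s) * exp (- (x / 2) / s)"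
        by (simp flip: exp_add)
      have "?d s = s powr (- \<mu> - 1) * exp (- s) * exp (- x / s) * (exp (- h / s) - 1 - (- h / s))"
        unfolding e1 e2 p1 by (simp add: algebra_simps divide_inverse)
      then have "\<bar>?d s\<bar> = s powr (- \<mu> - 1) * exp (- s) * (exp (- x / s) * \<bar>exp (- h / s) - 1 - (- h / s)\<bar>)"
        by (simp add: abs_mult)
      also have "\<dots> \<le> s powr (- \<mu> - 1) * exp (- s) * (exp (- (x / 2) / s) * (h\<^sup>2 * inverse (s\<^sup>2)))"
      proof (rule mult_left_mono)
        have "exp (- x / s) * \<bar>exp (- h / s) - 1 - (- h / s)\<bar>
            \<le> exp (- x / s) * (exp \<bar>- h / s\<bar> * (- h / s)\<^sup>2)"
          by (intro mult_left_mono exp_remainder_bound) auto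
        also have "\<dots> = exp ((\<bar>h\<bar> - x) / s) * (h\<^sup>2 * inverse (s\<^sup>2))"
        proof -
          have "\<bar>- h / s\<bar> = \<bar>h\<bar> / s" "(- h / s)\<^sup>2 = h\<^sup>2 * inverse (s\<^sup>2)"
            using s by (simp_all add: abs_mult power_mult_distrib divide_inverse power_inverse)
          moreover have "exp (- x / s) * exp (\<bar>h\<bar> / s) = exp ((\<bar>h\<bar> - x) / s)"
            by (simp add: diff_divide_distrib flip: exp_add)
          ultimately show ?thesis by (simp only: mult.assoc[symmetric])
        qed
        also have "\<dots> \<le> exp (- (x / 2) / s) * (h\<^sup>2 * inverse (s\<^sup>2))"
        proof -
          have "(\<bar>h\<bar> - x) / s \<le> - (x / 2) / s"
            using s h by (intro divide_right_mono) linarith+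
          then show ?thesis by (intro mult_right_mono) simp_all
        qed
        finally show "exp (- x / s) * \<bar>exp (- h / s) - 1 - (- h / s)\<bar>
            \<le> exp (- (x / 2) / s) * (h\<^sup>2 * inverse (s\<^sup>2))" .
      qed auto
      also have "\<dots> = h\<^sup>2 * (s powr (- (\<mu> + 2) - 1) * exp (- s - (x / 2) / s))"
        unfolding p2 e3 by (simp add: algebra_simps)
      finally show ?thesis .
    qed
    have "\<bar>LINT s:{0<..}|lborel. ?d s\<bar> \<le> (LINT s:{0<..}|lborel. \<bar>?d s\<bar>)"
      using set_integral_norm_bound[OF Id] by simp
    also have "\<dots> \<le> (LINT s:{0<..}|lborel. h\<^sup>2 * (s powr (- (\<mu> + 2) - 1) * exp (- s - (x / 2) / s)))"
      using set_integrable_abs[OF Id] x pw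
      by (intro set_integral_mono set_integrable_mult_right set_integrable_bessel) auto
    also have "\<dots> = h\<^sup>2 * ?C" by (simp add: bessel_integral_def)
    finally have main: "\<bar>bessel_integral \<mu> (x + h) - bessel_integral \<mu> x + h * bessel_integral (\<mu> + 1) x\<bar> \<le> h\<^sup>2 * ?C"
      using eq by simp
    have "(bessel_integral \<mu> (x + h) - bessel_integral \<mu> x) / h - (- bessel_integral (\<mu> + 1) x)
        = (bessel_integral \<mu> (x + h) - bessel_integral \<mu> x + h * bessel_integral (\<mu> + 1) x) / h"
      using h by (simp add: field_simps)
    also have "\<bar>\<dots>\<bar> \<le> h\<^sup>2 * ?C / \<bar>h\<bar>"
      unfolding abs_divide by (rule divide_right_mono[OF main abs_ge_zero])
    also have "\<dots> = \<bar>h\<bar> * ?C"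
      using h by (simp add: power2_eq_square field_simps abs_mult_self_eq)
    finally show ?thesis .
  qed
  have "((\<lambda>h. (bessel_integral \<mu> (x + h) - bessel_integral \<mu> x) / h - (- bessel_integral (\<mu> + 1) x)) \<longlongrightarrow> 0) (at 0)"
  proof (rule Lim_null_comparison)
    show "\<forall>\<^sub>F h in at 0. norm ((bessel_integral \<mu> (x + h) - bessel_integral \<mu> x) / h - (- bessel_integral (\<mu> + 1) x)) \<le> \<bar>h\<bar> * ?C"
      unfolding eventually_at using x bd by (intro exI[of _ "x / 2"]) auto
    show "((\<lambda>h. \<bar>h\<bar> * ?C) \<longlongrightarrow> 0) (at 0)"
      by (auto intro!: tendsto_eq_intros)
  qed
  from LIM_zero_cancel[OF this] show ?thesis
    unfolding DERIV_def .
qed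

text \<open>The substitution s -> x/s exchanges the two terms of the exponent and has Jacobian x/s^2
  in absolute value; the powers of x collect into \<open>x powr \<mu>\<close>.\<close>

lemma bessel_integral_reflect:
  assumes x: "x > 0"
  shows "bessel_integral (- \<mu>) x = x powr \<mu> * bessel_integral \<mu> x"
proof -
  let ?f = "\<lambda>s. s powr (\<mu> - 1) * exp (- s - x / s)"
  let ?g = "\<lambda>s. x powr \<mu> * (s powr (- \<mu> - 1) * exp (- s - x / s))"
  have img: "(\<lambda>s. x / s) ` {0<..} = {0<..}"
    using x by (auto simp: image_iff intro!: bexI[of _ "x / _"])
  have inj: "inj_on (\<lambda>s. x / s) {0<..}"
    using x by (auto simp: inj_on_def field_simps)
  have der: "((\<lambda>s. x / s) has_real_derivative - x / s\<^sup>2) (at s within {0<..})" if "s \<in> {0<..}" for s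
    using that by (auto intro!: derivative_eq_intros simp: power2_eq_square)
  have I: "set_integrable lborel {0<..} ?f" "set_integrable lborel {0<..} ?g"
    using set_integrable_bessel[OF x, of "- \<mu>"] set_integrable_bessel[OF x, of \<mu>] by simp_all
  have "?f absolutely_integrable_on {0<..}"
    using I(1) unfolding set_integrable_def by (subst integrable_completion) auto
  then have "integral {0<..} (\<lambda>s. \<bar>- x / s\<^sup>2\<bar> * ?f (x / s)) = integral {0<..} ?f"
    using has_absolute_integral_change_of_variables_1'[of "{0<..}" "\<lambda>s. x / s" "\<lambda>s. - x / s\<^sup>2" ?f "integral {0<..} ?f"]
    by (simp only: img inj der) auto
  also have "integral {0<..} (\<lambda>s. \<bar>- x / s\<^sup>2\<bar> * ?f (x / s)) = integral {0<..} ?g"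
  proof (rule integral_cong)
    fix s :: real assume "s \<in> {0<..}"
    then have s: "s > 0" by simp
    have "x / s\<^sup>2 * (x / s) powr (\<mu> - 1) = x powr \<mu> * s powr (- \<mu> - 1)"
      using x s by (simp add: powr_diff powr_divide powr_minus field_simps power2_eq_square)
    moreover have "- (x / s) - x / (x / s) = - s - x / s" "\<bar>- x / s\<^sup>2\<bar> = x / s\<^sup>2"
      using x s by simp_all
    ultimately show "\<bar>- x / s\<^sup>2\<bar> * ?f (x / s) = ?g s"
      by (simp only: mult.assoc[symmetric])
  qed
  finally show ?thesis
    unfolding bessel_integral_def using set_borel_integral_eq_integral(2)[OF I(1)] set_borel_integral_eq_integral(2)[OF I(2)]
    by simp
qed

lemma bessel_integral_tendsto_0:
  assumes a: "a > 0"
  shows "(bessel_integral (- a) \<longlongrightarrow> Gamma a) (at_right 0)"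
proof -
  \<comment> \<open>For y = x/s and 0 < b \<le> 1 one has 1 - exp(-y) \<le> min(y, 1) \<le>
    \<open>y powr b\<close>, while b < a keeps the remaining Gamma integral convergent. The choice b
    = 1 would fail for a \<le> 1.\<close>
  define b where "b = min 1 (a / 2)"
  have b: "0 < b" "b \<le> 1" "b < a" using a by (auto simp: b_def)
  have bd: "\<bar>bessel_integral (- a) x - Gamma a\<bar> \<le> x powr b * Gamma (a - b)" if x: "x > 0" for x
  proof -
    have I: "set_integrable lborel {0<..} (\<lambda>s. s powr (a - 1) * exp (- s - x / s))"
      using set_integrable_bessel[OF x, of "- a"] by simp
    note G = set_integrable_exp_powr[OF a]
    let ?d = "\<lambda>s. s powr (a - 1) * exp (- s - x / s) - s powr (a - 1) * exp (- s)"
    have eq: "bessel_integral (- a) x - Gamma a = (LINT s:{0<..}|lborel. ?d s)"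
      using I G by (simp add: bessel_integral_def set_integral_diff)
    have Id: "set_integrable lborel {0<..} ?d"
      using I G by (intro set_integral_diff) auto
    have pw: "\<bar>?d s\<bar> \<le> x powr b * (s powr ((a - b) - 1) * exp (- s))" if s: "s > 0" for s
    proof -
      have xs: "x / s > 0" using x s by simp
      have "1 - exp (- (x / s)) \<le> (x / s) powr b"
      proof (cases "x / s \<le> 1")
        case True
        have "1 - exp (- (x / s)) \<le> x / s"
          using exp_ge_add_one_self[of "- (x / s)"] by linarith
        also have "\<dots> = (x / s) powr 1" using xs by (simp only: powr_one)
        also have "\<dots> \<le> (x / s) powr b"
          using True b x s by (intro powr_mono') auto
        finally show ?thesis .
      next
        case False
        then have "(x / s) powr b \<ge> 1" using b by (intro ge_one_powr_ge_zero) auto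
        then show ?thesis by (smt (verit) exp_gt_zero)
      qed
      moreover have "exp (- (x / s)) \<le> 1" using xs by simp
      ultimately have "\<bar>exp (- (x / s)) - 1\<bar> \<le> (x / s) powr b" by linarith
      then have "s powr (a - 1) * exp (- s) * \<bar>exp (- (x / s)) - 1\<bar> \<le> s powr (a - 1) * exp (- s) * (x / s) powr b"
        by (intro mult_left_mono) auto
      moreover have "\<bar>?d s\<bar> = s powr (a - 1) * exp (- s) * \<bar>exp (- (x / s)) - 1\<bar>"
      proof -
        have "?d s = s powr (a - 1) * exp (- s) * (exp (- (x / s)) - 1)"
          by (simp add: exp_diff exp_minus algebra_simps divide_inverse)
        then show ?thesis by (simp add: abs_mult)
      qed
      moreover have "s powr (a - 1) * exp (- s) * (x / s) powr b = x powr b * (s powr ((a - b) - 1) * exp (- s))"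
        using s x by (simp add: powr_divide powr_diff powr_add field_simps)
      ultimately show ?thesis by simp
    qed
    have "\<bar>LINT s:{0<..}|lborel. ?d s\<bar> \<le> (LINT s:{0<..}|lborel. \<bar>?d s\<bar>)"
      using set_integral_norm_bound[OF Id] by simp
    also have "\<dots> \<le> (LINT s:{0<..}|lborel. x powr b * (s powr ((a - b) - 1) * exp (- s)))"
      using set_integrable_abs[OF Id] x pw b
      by (intro set_integral_mono set_integrable_mult_right set_integrable_exp_powr) auto
    also have "\<dots> = x powr b * Gamma (a - b)"
      using set_integrable_exp_powr(2)[of "a - b"] b by simp
    finally show ?thesis using eq by simp
  qed
  have "((\<lambda>x. bessel_integral (- a) x - Gamma a) \<longlongrightarrow> 0) (at_right 0)"
  proof (rule Lim_null_comparison)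
    show "\<forall>\<^sub>F x in at_right 0. norm (bessel_integral (- a) x - Gamma a) \<le> x powr b * Gamma (a - b)"
      using bd by (auto simp: eventually_at_right_less eventually_at_filter)
    have "((\<lambda>x::real. x powr b) \<longlongrightarrow> 0) (at_right 0)"
      using b(1) by real_asymp
    then show "((\<lambda>x. x powr b * Gamma (a - b)) \<longlongrightarrow> 0) (at_right 0)"
      by (auto intro: tendsto_mult_left_zero)
  qed
  then show ?thesis by (simp add: LIM_zero_iff)
qed

text \<open>As a function of \<mu> the integrand is the exponential of an affine function times a
  positive constant, so convexity passes to the integral, and no dominating function is
  required.\<close>

lemma isCont_bessel_integral_index:
  assumes x: "x > 0"
  shows "isCont (\<lambda>\<mu>. bessel_integral \<mu> x) \<mu>"
proof -
  have "convex_on UNIV (\<lambda>\<mu>. bessel_integral \<mu> x)"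
  proof (rule convex_onI)
    fix t \<mu> \<nu> :: real assume t: "0 < t" "t < 1"
    let ?m = "(1 - t) *\<^sub>R \<mu> + t *\<^sub>R \<nu>"
    note I = set_integrable_bessel[OF x]
    have "bessel_integral ?m x \<le> (LINT s:{0<..}|lborel. (1 - t) * (s powr (- \<mu> - 1) * exp (- s - x / s))
        + t * (s powr (- \<nu> - 1) * exp (- s - x / s)))"
      unfolding bessel_integral_def
    proof (rule set_integral_mono)
      fix s :: real assume "s \<in> {0<..}"
      then have s: "s > 0" by simp
      have "s powr (- ?m - 1) = exp ((1 - t) *\<^sub>R ((- \<mu> - 1) * ln s) + t *\<^sub>R ((- \<nu> - 1) * ln s))"
        using s by (simp add: powr_def algebra_simps)
      also have "\<dots> \<le> (1 - t) * exp ((- \<mu> - 1) * ln s) + t * exp ((- \<nu> - 1) * ln s)"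
        using t by (intro convex_onD[OF exp_convex]) auto
      finally have "s powr (- ?m - 1) \<le> (1 - t) * s powr (- \<mu> - 1) + t * s powr (- \<nu> - 1)"
        using s by (simp add: powr_def)
      from mult_right_mono[OF this, of "exp (- s - x / s)"]
      show "s powr (- ?m - 1) * exp (- s - x / s) \<le> (1 - t) * (s powr (- \<mu> - 1) * exp (- s - x / s))
        + t * (s powr (- \<nu> - 1) * exp (- s - x / s))"
        by (simp add: algebra_simps)
    qed (rule I set_integral_add(1) set_integrable_mult_right)+
    also have "\<dots> = (1 - t) * bessel_integral \<mu> x + t * bessel_integral \<nu> x"
      unfolding bessel_integral_def
      by (simp only: set_integral_add(2)[OF set_integrable_mult_right[OF I] set_integrable_mult_right[OF I]]
          set_integral_mult_right)
    finally show "bessel_integral ?m x \<le> (1 - t) * bessel_integral \<mu> x + t * bessel_integral \<nu> x" .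
  qed auto
  from convex_on_continuous[OF open_UNIV this] show ?thesis
    by (simp add: continuous_on_eq_continuous_at)
qed

section \<open>The Bessel series\<close>

lemma rGamma_shift_bounded:
  obtains N C where "\<And>j z. \<lbrakk>j \<ge> N; norm z \<le> R\<rbrakk> \<Longrightarrow> norm (rGamma (of_nat j + 1 + z :: complex)) \<le> C"
proof -
  obtain N :: nat where N: "real N \<ge> R" using real_arch_simple by blast
  have "compact ((\<lambda>z. rGamma (of_nat N + 1 + z :: complex)) ` cball 0 R)"
    by (intro compact_continuous_image continuous_intros continuous_on_rGamma[THEN continuous_on_compose2]) auto
  then obtain C where C: "\<And>z. norm z \<le> R \<Longrightarrow> norm (rGamma (of_nat N + 1 + z :: complex)) \<le> C"
    using compact_imp_bounded bounded_iff by (metis (no_types, lifting) dist_0_norm image_eqI mem_cball)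
  have "norm (rGamma (of_nat j + 1 + z :: complex)) \<le> C" if "j \<ge> N" "norm z \<le> R" for j z
    using that(1)
  proof (induction j rule: dec_induct)
    case base
    then show ?case using C that by blast
  next
    case (step j)
    have "1 \<le> Re (of_nat j + 1 + z)"
      using N step.hyps that(2) abs_Re_le_cmod[of z] by simp
    then have ge: "1 \<le> norm (of_nat j + 1 + z)"
      using complex_Re_le_cmod order_trans by blast
    have "(of_nat j + 1 + z) * rGamma (of_nat (Suc j) + 1 + z) = rGamma (of_nat j + 1 + z)"
      using rGamma_plus1[of "of_nat j + 1 + z"] by (simp add: algebra_simps)
    then have "norm (of_nat j + 1 + z) * norm (rGamma (of_nat (Suc j) + 1 + z)) \<le> C"
      using step.IH by (metis norm_mult)
    moreover have "norm (rGamma (of_nat (Suc j) + 1 + z)) \<le> norm (of_nat j + 1 + z) * norm (rGamma (of_nat (Suc j) + 1 + z))"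
      using mult_right_mono[OF ge norm_ge_zero] by simp
    ultimately show ?case by linarith
  qed
  then show ?thesis using that by blast
qed

text \<open>This is \<open>x powr (- \<mu>/2) I\<^sub>\<mu>(2 \<surd>x)\<close>, with \<open>I\<^sub>\<mu>\<close> the modified Bessel function of the first kind;
  using \<open>rGamma\<close> makes it entire in \<open>\<mu>\<close>.\<close>

definition bessel_series :: "real \<Rightarrow> real \<Rightarrow> real" where
  "bessel_series \<mu> x = (\<Sum>j. rGamma (real j + 1 + \<mu>) / fact j * x ^ j)"

lemma summable_bessel_series: "summable (\<lambda>j. rGamma (real j + 1 + \<mu>) / fact j * x ^ j)"
proof -
  obtain N C where NC: "\<And>j z. \<lbrakk>j \<ge> N; norm z \<le> \<bar>\<mu>\<bar>\<rbrakk> \<Longrightarrow> norm (rGamma (of_nat j + 1 + z :: complex)) \<le> C"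
    using rGamma_shift_bounded by blast
  show ?thesis
  proof (rule summable_comparison_test)
    show "summable (\<lambda>j. C * (inverse (fact j) * \<bar>x\<bar> ^ j))"
      by (intro summable_mult summable_exp)
    show "\<exists>N. \<forall>n\<ge>N. norm (rGamma (real n + 1 + \<mu>) / fact n * x ^ n) \<le> C * (inverse (fact n) * \<bar>x\<bar> ^ n)"
    proof (intro exI[of _ N] allI impI)
      fix n assume "n \<ge> N"
      have "norm (rGamma (of_real (real n + 1 + \<mu>) :: complex)) \<le> C"
        using NC[OF \<open>n \<ge> N\<close>, of "of_real \<mu>"] by simp
      then have "\<bar>rGamma (real n + 1 + \<mu>)\<bar> \<le> C"
        by (simp only: rGamma_complex_of_real norm_of_real)
      then have "\<bar>rGamma (real n + 1 + \<mu>)\<bar> * (inverse (fact n) * \<bar>x\<bar> ^ n) \<le> C * (inverse (fact n) * \<bar>x\<bar> ^ n)"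
        by (intro mult_right_mono) auto
      then show "norm (rGamma (real n + 1 + \<mu>) / fact n * x ^ n) \<le> C * (inverse (fact n) * \<bar>x\<bar> ^ n)"
        by (simp add: abs_mult power_abs divide_inverse mult.assoc)
    qed
  qed
qed

lemma bessel_series_sums: "(\<lambda>j. rGamma (real j + 1 + \<mu>) / fact j * x ^ j) sums bessel_series \<mu> x"
  unfolding bessel_series_def by (rule summable_sums[OF summable_bessel_series])

lemma bessel_series_has_derivative:
  "(bessel_series \<mu> has_real_derivative bessel_series (\<mu> + 1) x) (at x)"
proof -
  have "diffs (\<lambda>j. rGamma (real j + 1 + \<mu>) / fact j) j = rGamma (real j + 1 + (\<mu> + 1)) / fact j" for j
    by (simp add: diffs_def add_ac divide_simps)
  then show ?thesis
    using termdiffs_strong_converges_everywhere[of "\<lambda>j. rGamma (real j + 1 + \<mu>) / fact j" x, OF summable_bessel_series]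
    unfolding bessel_series_def[abs_def] by (simp only:)
qed

lemma bessel_series_0: "bessel_series \<mu> 0 = rGamma (1 + \<mu>)"
  unfolding bessel_series_def powser_zero by simp

text \<open>Coefficientwise this is
  \<open>rGamma (j + \<mu>) = (j + \<mu>) * rGamma (j + 1 + \<mu>)\<close>: the summand \<mu> gives
  the first series, and the summand j gives the second after an index shift.\<close>

lemma bessel_series_recurrence:
  "bessel_series (\<mu> - 1) x = \<mu> * bessel_series \<mu> x + x * bessel_series (\<mu> + 1) x"
proof -
  let ?g = "\<lambda>j. real j * (rGamma (real j + 1 + \<mu>) / fact j * x ^ j)"
  have "(\<lambda>j. x * (rGamma (real j + 1 + (\<mu> + 1)) / fact j * x ^ j)) sums (x * bessel_series (\<mu> + 1) x)"
    by (intro sums_mult bessel_series_sums)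
  moreover have "x * (rGamma (real j + 1 + (\<mu> + 1)) / fact j * x ^ j) = ?g (Suc j)" for j
    by (simp add: add_ac divide_simps del: of_nat_Suc) (simp add: algebra_simps)
  ultimately have "(\<lambda>j. ?g (Suc j)) sums (x * bessel_series (\<mu> + 1) x)" by (simp only:)
  then have "?g sums (x * bessel_series (\<mu> + 1) x)"
    by (rule sums_Suc_imp[rotated]) simp
  then have "(\<lambda>j. \<mu> * (rGamma (real j + 1 + \<mu>) / fact j * x ^ j) + ?g j) sums
      (\<mu> * bessel_series \<mu> x + x * bessel_series (\<mu> + 1) x)"
    by (intro sums_add sums_mult bessel_series_sums)
  moreover have "\<mu> * (rGamma (real j + 1 + \<mu>) / fact j * x ^ j) + ?g j
      = rGamma (real j + 1 + (\<mu> - 1)) / fact j * x ^ j" for j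
  proof -
    have "rGamma (real j + 1 + (\<mu> - 1)) = (real j + \<mu>) * rGamma (real j + 1 + \<mu>)"
      using rGamma_plus1[of "real j + \<mu>"] by (simp add: add_ac)
    then show ?thesis by (simp only:) (simp add: algebra_simps add_divide_distrib)
  qed
  ultimately show ?thesis
    using bessel_series_sums[of "\<mu> - 1" x] sums_unique2 by auto
qed

section \<open>Noninteger indices: the combination of two series that equals the integral\<close>

text \<open>This is \<open>2 * x powr (- \<mu> / 2)\<close> times the modified Bessel function of
  the second kind at 2 sqrt x, by its usual expression through the first kind. At integer \<mu>
  division by zero makes it 0, and the rules for derivative and reflection remain true there, so
  they can be stated for all \<mu>.\<close>

definition bessel_combination :: "real \<Rightarrow> real \<Rightarrow> real" where
  "bessel_combination \<mu> x = pi / sin (pi * \<mu>) * (x powr (- \<mu>) * bessel_series (- \<mu>) x - bessel_series \<mu> x)"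

lemma sin_pi_eq_0_iff: "sin (pi * \<mu>) = 0 \<longleftrightarrow> \<mu> \<in> \<int>" for \<mu> :: real
proof -
  have "sin (pi * \<mu>) = 0 \<longleftrightarrow> (\<exists>i. \<mu> = real_of_int i)"
    by (simp add: sin_zero_iff_int2 mult.commute)
  then show ?thesis by (auto simp: Ints_def)
qed

text \<open>Both series move to index \<mu> + 1 with a plus sign: the recurrence collapses the
  product rule for the first one. The minus sign comes from the sine, which changes sign when its
  argument grows by pi.\<close>

lemma bessel_combination_has_derivative:
  assumes "x > 0"
  shows "(bessel_combination \<mu> has_real_derivative - bessel_combination (\<mu> + 1) x) (at x)"
proof -
  have "(bessel_combination \<mu> has_real_derivative
      pi / sin (pi * \<mu>) * ((- \<mu> * x powr (- \<mu> - 1) * bessel_series (- \<mu>) x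
        + bessel_series (- \<mu> + 1) x * x powr (- \<mu>)) - bessel_series (\<mu> + 1) x)) (at x)"
    unfolding bessel_combination_def[abs_def]
    by (intro DERIV_cmult DERIV_diff DERIV_mult bessel_series_has_derivative has_real_derivative_powr assms)
  moreover have "- \<mu> * x powr (- \<mu> - 1) * bessel_series (- \<mu>) x + bessel_series (- \<mu> + 1) x * x powr (- \<mu>)
      = x powr (- (\<mu> + 1)) * bessel_series (- (\<mu> + 1)) x"
  proof -
    have "x powr (- \<mu>) = x powr (- (\<mu> + 1)) * x"
      using assms powr_add[of x "- (\<mu> + 1)" 1] by simp
    moreover have e: "- \<mu> - 1 = - (\<mu> + 1)" by simp
    moreover have "bessel_series (- (\<mu> + 1)) x = - \<mu> * bessel_series (- \<mu>) x + x * bessel_series (- \<mu> + 1) x"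
      using bessel_series_recurrence[of "- \<mu>" x] unfolding e .
    ultimately show ?thesis
      by (simp only:) (simp only: algebra_simps)
  qed
  moreover have "sin (pi * (\<mu> + 1)) = - sin (pi * \<mu>)"
    by (simp add: distrib_left)
  ultimately show ?thesis
    by (simp add: bessel_combination_def)
qed

text \<open>Negating \<mu> exchanges the two series and flips the sign of the sine, so only a power
  of x remains.\<close>

lemma bessel_combination_reflect:
  assumes "x > 0"
  shows "bessel_combination (- \<mu>) x = x powr \<mu> * bessel_combination \<mu> x"
proof -
  have "x powr \<mu> * x powr (- \<mu>) = 1"
    using assms by (simp flip: powr_add)
  then have "x powr \<mu> * (x powr (- \<mu>) * y - z) = y - x powr \<mu> * z" for y z
    by (simp add: right_diff_distrib mult.assoc[symmetric])
  then show ?thesis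
    unfolding bessel_combination_def by (simp add: algebra_simps)
qed

text \<open>Because a > 0, the term with \<open>x powr a\<close> dies and only the constant
  coefficient of the other series survives; Euler's reflection formula turns it into
  \<open>Gamma a\<close>.\<close>

lemma bessel_combination_tendsto_0:
  assumes a: "0 < a" "a < 1"
  shows "(bessel_combination (- a) \<longlongrightarrow> Gamma a) (at_right 0)"
proof -
  have c: "isCont (bessel_series \<mu>) 0" for \<mu>
    using DERIV_isCont[OF bessel_series_has_derivative] .
  have t: "(bessel_series \<mu> \<longlongrightarrow> rGamma (1 + \<mu>)) (at_right 0)" for \<mu>
    using isContD[OF c[of \<mu>]] by (auto simp: bessel_series_0 intro: filterlim_mono at_le)
  have p: "((\<lambda>x::real. x powr a) \<longlongrightarrow> 0) (at_right 0)"
    using a(1) by real_asymp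
  have "((\<lambda>x. pi / sin (pi * (- a)) * (x powr (- (- a)) * bessel_series (- (- a)) x - bessel_series (- a) x))
      \<longlongrightarrow> pi / sin (pi * (- a)) * (0 * rGamma (1 + a) - rGamma (1 + (- a)))) (at_right 0)"
    using t[of a] t[of "- a"] p by (intro tendsto_intros) auto
  moreover have "pi / sin (pi * (- a)) * (0 * rGamma (1 + a) - rGamma (1 + (- a))) = Gamma a"
  proof -
    have "a \<notin> \<int>" using a by (auto elim!: Ints_cases)
    then have s: "sin (pi * a) \<noteq> 0" using sin_pi_eq_0_iff by blast
    have "Gamma a * Gamma (1 - a) = pi / sin (pi * a)"
    proof -
      have "Gamma (1 - complex_of_real a) = of_real (Gamma (1 - a))"
        using Gamma_complex_of_real[of "1 - a"] by simp
      moreover have "sin (complex_of_real pi * of_real a) = of_real (sin (pi * a))"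
        using sin_of_real[of "pi * a", where 'a = complex] by simp
      ultimately have "complex_of_real (Gamma a * Gamma (1 - a)) = of_real (pi / sin (pi * a))"
        using Gamma_reflection_complex[of "of_real a"] by (simp add: Gamma_complex_of_real)
      then show ?thesis by (simp only: of_real_eq_iff)
    qed
    moreover have "Gamma (1 - a) > 0" using a by (intro Gamma_real_pos) auto
    ultimately show ?thesis using s by (simp add: rGamma_inverse_Gamma field_simps)
  qed
  ultimately show ?thesis
    unfolding bessel_combination_def[abs_def] by simp
qed

text \<open>For \<open>0 < a < 1\<close> the functions \<open>u = D (- a)\<close> and \<open>v = D (a - 1)\<close> satisfy
  \<open>u' = - x powr (a - 1) * v\<close> and \<open>v' = - x powr (- a) * u\<close> and vanish at \<open>0\<close>; since the coefficients
  are integrable at \<open>0\<close>, a Gronwall estimate for \<open>u\<^sup>2 + v\<^sup>2\<close> gives \<open>u = v = 0\<close>.\<close>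

lemma bessel_system_unique_strip:
  fixes D :: "real \<Rightarrow> real \<Rightarrow> real"
  assumes der: "\<And>\<mu> x. x > 0 \<Longrightarrow> (D \<mu> has_real_derivative - D (\<mu> + 1) x) (at x)"
    and rf: "\<And>\<mu> x. x > 0 \<Longrightarrow> D (- \<mu>) x = x powr \<mu> * D \<mu> x"
    and lim: "\<And>a. \<lbrakk>0 < a; a < 1\<rbrakk> \<Longrightarrow> (D (- a) \<longlongrightarrow> 0) (at_right 0)"
    and a: "0 < a" "a < 1" and x: "x > 0"
  shows "D (- a) x = 0"
proof -
  let ?u = "D (- a)" and ?v = "D (- (1 - a))"
  \<comment> \<open>The antiderivative of the sum of the two coefficients of the system; 0 < a < 1
    makes it vanish at 0, so \<open>exp (- ?W x)\<close> is a harmless integrating factor.\<close>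
  let ?W = "\<lambda>x. x powr a / a + x powr (1 - a) / (1 - a)"
  define E where "E = (\<lambda>x. ((?u x)\<^sup>2 + (?v x)\<^sup>2) * exp (- ?W x))"
  have du: "(?u has_real_derivative - (y powr (a - 1) * ?v y)) (at y)" if "y > 0" for y
  proof -
    have "- a + 1 = - (a - 1)" "- (1 - a) = a - 1" by auto
    then show ?thesis using der[OF that, of "- a"] rf[OF that, of "a - 1"] by simp
  qed
  have dv: "(?v has_real_derivative - (y powr (- a) * ?u y)) (at y)" if "y > 0" for y
  proof -
    have "- (1 - a) + 1 = - (- a)" by auto
    then show ?thesis using der[OF that, of "- (1 - a)"] rf[OF that, of "- a"] by simp
  qed
  have dW: "(?W has_real_derivative y powr (a - 1) + y powr (- a)) (at y)" if "y > 0" for y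
    using that a by (auto intro!: derivative_eq_intros)
  \<comment> \<open>The derivative of u^2 + v^2 is -2uv times the sum of the coefficients, and the
    integrating factor adds -(u^2 + v^2) times the same sum; together they form a negative perfect
    square, so \<open>E\<close> decreases from its limit 0.\<close>
  have dE: "(E has_real_derivative
      - ((?u y + ?v y)\<^sup>2 * (y powr (a - 1) + y powr (- a)) * exp (- ?W y))) (at y)" if "y > 0" for y
    unfolding E_def
    by (rule derivative_eq_intros du[OF that] dv[OF that] dW[OF that] refl)+
      (simp add: algebra_simps power2_eq_square)
  have le: "E x \<le> E y" if "0 < y" "y < x" for y
  proof (rule DERIV_nonpos_imp_nonincreasing[of y x E])
    show "y \<le> x" using that by simp
    fix z assume "y \<le> z" "z \<le> x"
    then have "z > 0" using that by simp
    then show "\<exists>d. (E has_real_derivative d) (at z) \<and> d \<le> 0"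
      using dE[of z] by (intro exI[of _ "- ((?u z + ?v z)\<^sup>2 * (z powr (a - 1) + z powr (- a)) * exp (- ?W z))"]) auto
  qed
  have W0: "((\<lambda>x. - ?W x) \<longlongrightarrow> - 0) (at_right 0)"
  proof -
    have p: "((\<lambda>x::real. x powr b) \<longlongrightarrow> 0) (at_right 0)" if "b > 0" for b
      using that by real_asymp
    have "((\<lambda>x. - ?W x) \<longlongrightarrow> - (0 / a + 0 / (1 - a))) (at_right 0)"
      using a by (intro tendsto_minus tendsto_add tendsto_divide p tendsto_const) auto
    then show ?thesis by simp
  qed
  have "(E \<longlongrightarrow> (0\<^sup>2 + 0\<^sup>2) * exp (- 0)) (at_right 0)"
    unfolding E_def using lim[of a] lim[of "1 - a"] a
    by (intro tendsto_mult tendsto_add tendsto_power tendsto_exp W0) auto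
  then have "(E \<longlongrightarrow> 0) (at_right 0)" by simp
  then have "E x \<le> 0"
  proof (rule tendsto_lowerbound)
    show "\<forall>\<^sub>F y in at_right 0. E x \<le> E y"
      using eventually_at_right_real[OF x] by eventually_elim (use le in auto)
  qed simp
  then have "(?u x)\<^sup>2 + (?v x)\<^sup>2 \<le> 0"
    unfolding E_def by (simp add: mult_le_0_iff)
  then show ?thesis by (metis sum_power2_le_zero_iff)
qed

text \<open>Differentiating a function that vanishes on the positive axis shows that the next index
  vanishes too, so the strip propagates upwards to all positive nonintegers; reflection supplies the
  negative ones.\<close>

lemma bessel_system_unique:
  fixes D :: "real \<Rightarrow> real \<Rightarrow> real"
  assumes der: "\<And>\<mu> x. x > 0 \<Longrightarrow> (D \<mu> has_real_derivative - D (\<mu> + 1) x) (at x)"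
    and rf: "\<And>\<mu> x. x > 0 \<Longrightarrow> D (- \<mu>) x = x powr \<mu> * D \<mu> x"
    and lim: "\<And>a. \<lbrakk>0 < a; a < 1\<rbrakk> \<Longrightarrow> (D (- a) \<longlongrightarrow> 0) (at_right 0)"
    and \<mu>: "\<mu> \<notin> \<int>" and x: "x > 0"
  shows "D \<mu> x = 0"
proof -
  have up: "D (- a + real n) x = 0" if "0 < a" "a < 1" "x > 0" for a n x
    using that(3)
  proof (induction n arbitrary: x)
    case 0
    then show ?case using bessel_system_unique_strip[OF der rf lim that(1,2)] by simp
  next
    case (Suc n)
    have "(D (- a + real n) has_real_derivative 0) (at x)"
    proof (subst DERIV_cong_ev[OF refl _ refl])
      show "\<forall>\<^sub>F y in nhds x. D (- a + real n) y = 0"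
        using eventually_nhds_in_open[of "{0<..}" x] Suc by (auto elim: eventually_mono)
    qed simp
    moreover have "(D (- a + real n) has_real_derivative - D (- a + real (Suc n)) x) (at x)"
      using der[OF Suc.prems, of "- a + real n"] by (simp add: add_ac)
    ultimately show ?case using DERIV_unique by fastforce
  qed
  have pos: "D \<kappa> x = 0" if "\<kappa> \<notin> \<int>" "\<kappa> > 0" for \<kappa>
  proof -
    \<comment> \<open>The smallest integer above \<kappa>, so that \<kappa> = -a + n with 0 < a < 1;
      both inequalities are strict because \<kappa> is not an integer.\<close>
    define n where "n = nat \<lfloor>\<kappa>\<rfloor> + 1"
    define a where "a = real n - \<kappa>"
    have "real n = of_int \<lfloor>\<kappa>\<rfloor> + 1" using that by (simp add: n_def)
    moreover have "of_int \<lfloor>\<kappa>\<rfloor> \<noteq> \<kappa>" using that(1) by (metis Ints_of_int)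
    ultimately have "0 < a" "a < 1" unfolding a_def by linarith+
    then show ?thesis using up[of a x n] x by (simp add: a_def)
  qed
  show ?thesis
  proof (cases "\<mu> > 0")
    case True
    then show ?thesis using pos \<mu> by blast
  next
    case False
    then have "D (- \<mu>) x = 0" using \<mu> by (intro pos) (auto simp: less_le)
    then show ?thesis using rf[OF x, of "- \<mu>"] by simp
  qed
qed

section \<open>Integer indices: differentiation of the series in the index\<close>

text \<open>The derivative of 1/Gamma. The case split is needed because the digamma function has
  poles at the nonpositive integers; at -k the derivative is (-1)^k k!, with k recovered from the
  norm.\<close>

definition rGamma_deriv :: "'a::Gamma \<Rightarrow> 'a" where
  "rGamma_deriv z = (if z \<in> \<int>\<^sub>\<le>\<^sub>0 then (- 1) ^ nat \<lfloor>norm z\<rfloor> * fact (nat \<lfloor>norm z\<rfloor>) else - rGamma z * Digamma z)"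

lemma rGamma_deriv_of_real: "rGamma_deriv (complex_of_real x) = complex_of_real (rGamma_deriv x)"
proof (cases "x \<in> \<int>\<^sub>\<le>\<^sub>0")
  case False
  then have "x \<noteq> 0" by auto
  then show ?thesis using False
    by (simp add: rGamma_deriv_def of_real_in_nonpos_Ints_iff rGamma_complex_of_real Polygamma_of_real)
qed (simp add: rGamma_deriv_def of_real_in_nonpos_Ints_iff)

text \<open>The index is made complex: a series of holomorphic functions that is locally dominated
  may be differentiated termwise, with a bound on the terms alone and none on their derivatives. The
  real statement is the real part along the real axis.\<close>

lemma bessel_series_has_index_derivative:
  obtains L where "((\<lambda>\<mu>. bessel_series \<mu> x) has_real_derivative L) (at \<mu>)"
    and "(\<lambda>j. rGamma_deriv (real j + 1 + \<mu>) / fact j * x ^ j) sums L"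
proof -
  let ?f = "\<lambda>j z. rGamma (of_nat j + 1 + z :: complex) / fact j * of_real x ^ j"
  let ?f' = "\<lambda>j z. rGamma_deriv (of_nat j + 1 + z :: complex) / fact j * of_real x ^ j"
  have "\<exists>g g'. \<forall>z\<in>UNIV. ((\<lambda>n. ?f n z) sums g z) \<and> ((\<lambda>n. ?f' n z) sums g' z) \<and> (g has_field_derivative g' z) (at z)"
  proof (rule series_and_derivative_comparison_complex)
    show "(?f n has_field_derivative ?f' n z) (at z)" for n z
    proof -
      have "(rGamma has_field_derivative rGamma_deriv w) (at w)" for w :: complex
        unfolding rGamma_deriv_def by (rule has_field_derivative_rGamma)
      then have "((\<lambda>z. rGamma (of_nat n + 1 + z)) has_field_derivative rGamma_deriv (of_nat n + 1 + z) * (0 + 1)) (at z)"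
        by (rule DERIV_chain2) (intro DERIV_add DERIV_const DERIV_ident)
      from DERIV_cmult_right[OF DERIV_cdivide[OF this, of "fact n"], of "of_real x ^ n"]
      show ?thesis by simp
    qed
    fix z :: complex
    obtain N C where NC: "\<And>j w. \<lbrakk>j \<ge> N; norm w \<le> norm z + 1\<rbrakk> \<Longrightarrow> norm (rGamma (of_nat j + 1 + w :: complex)) \<le> C"
      using rGamma_shift_bounded by blast
    define h where "h = (\<lambda>j. complex_of_real (\<bar>C\<bar> * (inverse (fact j) * \<bar>x\<bar> ^ j)))"
    have "summable (\<lambda>j. \<bar>C\<bar> * (inverse (fact j) * \<bar>x\<bar> ^ j))"
      by (intro summable_mult summable_exp)
    then have "summable h" unfolding h_def by (rule summable_of_real)
    moreover have "range h \<subseteq> \<real>\<^sub>\<ge>\<^sub>0" by (auto simp: h_def simp del: of_real_mult)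
    moreover have "\<forall>\<^sub>F n in sequentially. \<forall>y\<in>ball z 1 \<inter> UNIV. cmod (?f n y) \<le> cmod (h n)"
      using eventually_ge_at_top[of N]
    proof eventually_elim
      case (elim n)
      show ?case
      proof
        fix y assume "y \<in> ball z 1 \<inter> UNIV"
        then have "norm y \<le> norm z + 1"
          using norm_triangle_ineq2[of y z] by (auto simp: dist_norm norm_minus_commute)
        then have "norm (rGamma (of_nat n + 1 + y)) \<le> \<bar>C\<bar>"
          using NC[OF elim] by fastforce
        then have "norm (rGamma (of_nat n + 1 + y)) * (inverse (fact n) * \<bar>x\<bar> ^ n) \<le> \<bar>C\<bar> * (inverse (fact n) * \<bar>x\<bar> ^ n)"
          by (intro mult_right_mono) auto
        then show "cmod (?f n y) \<le> cmod (h n)"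
          unfolding h_def norm_of_real by (simp add: norm_mult norm_divide norm_power norm_inverse abs_mult divide_inverse mult.assoc)
      qed
    qed
    ultimately show "\<exists>d h. 0 < d \<and> summable h \<and> range h \<subseteq> \<real>\<^sub>\<ge>\<^sub>0 \<and>
        (\<forall>\<^sub>F n in sequentially. \<forall>y\<in>ball z d \<inter> UNIV. cmod (?f n y) \<le> cmod (h n))"
      by (intro exI[of _ 1] exI[of _ h]) auto
  qed auto
  then obtain g g' where g: "\<And>z. (\<lambda>n. ?f n z) sums g z" "\<And>z. (\<lambda>n. ?f' n z) sums g' z"
      "\<And>z. (g has_field_derivative g' z) (at z)"
    by blast
  have f_real: "?f n (of_real \<mu>) = of_real (rGamma (real n + 1 + \<mu>) / fact n * x ^ n)" for n \<mu>
    using rGamma_complex_of_real[of "real n + 1 + \<mu>"] by simp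
  have g_real: "g (of_real \<mu>) = of_real (bessel_series \<mu> x)" for \<mu>
  proof (rule sums_unique2[OF g(1)])
    show "(\<lambda>n. ?f n (of_real \<mu>)) sums of_real (bessel_series \<mu> x)"
      unfolding f_real sums_of_real_iff by (rule bessel_series_sums)
  qed
  have f'_real: "?f' n (of_real \<mu>) = of_real (rGamma_deriv (real n + 1 + \<mu>) / fact n * x ^ n)" for n
    using rGamma_deriv_of_real[of "real n + 1 + \<mu>"] by simp
  have "(\<lambda>n. rGamma_deriv (real n + 1 + \<mu>) / fact n * x ^ n) sums Re (g' (of_real \<mu>))"
    using sums_Re[OF g(2)[of "of_real \<mu>"]] unfolding f'_real Re_complex_of_real .
  moreover have "((\<lambda>\<mu>. bessel_series \<mu> x) has_real_derivative Re (g' (of_real \<mu>))) (at \<mu>)"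
    using bounded_linear.has_vector_derivative[OF bounded_linear_Re has_vector_derivative_real_field[OF g(3)[of "of_real \<mu>"]]]
    by (simp add: g_real has_real_derivative_iff_has_vector_derivative)
  ultimately show ?thesis using that by blast
qed

lemma bessel_integral_nonint:
  assumes "\<mu> \<notin> \<int>" and "x > 0"
  shows "bessel_integral \<mu> x = bessel_combination \<mu> x"
proof -
  let ?D = "\<lambda>\<mu> x. bessel_integral \<mu> x - bessel_combination \<mu> x"
  have "?D \<mu> x = 0"
  proof (rule bessel_system_unique[of ?D, OF _ _ _ assms])
    fix \<mu> x :: real assume "x > 0"
    then show "(?D \<mu> has_real_derivative - ?D (\<mu> + 1) x) (at x)"
      using DERIV_diff[OF bessel_integral_has_derivative bessel_combination_has_derivative, of x \<mu> \<mu>] by simp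
    show "?D (- \<mu>) x = x powr \<mu> * ?D \<mu> x"
      using bessel_integral_reflect[OF \<open>x > 0\<close>] bessel_combination_reflect[OF \<open>x > 0\<close>]
      by (simp add: right_diff_distrib)
  next
    fix a :: real assume a: "0 < a" "a < 1"
    show "(?D (- a) \<longlongrightarrow> 0) (at_right 0)"
      using tendsto_diff[OF bessel_integral_tendsto_0[OF a(1)] bessel_combination_tendsto_0[OF a]] by simp
  qed
  then show ?thesis by simp
qed

lemma bessel_series_nat_sums:
  "(\<lambda>j. x ^ j / (fact j * fact (m + j))) sums bessel_series (real m) x"
proof -
  have "rGamma (real j + 1 + real m) = inverse (fact (m + j))" for j
  proof -
    have "real j + 1 + real m = of_nat (Suc (m + j))" by simp
    then show ?thesis by (simp only: rGamma_inverse_Gamma Gamma_fact[symmetric] of_nat_Suc)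
  qed
  then show ?thesis
    using bessel_series_sums[of "real m" x] by (simp add: divide_inverse mult_ac)
qed

text \<open>The first m coefficients vanish because 1/Gamma is zero at the nonpositive integers; the
  rest is an index shift. This is the classical coincidence of the Bessel functions of orders m and
  -m.\<close>

lemma bessel_series_minus_nat: "bessel_series (- real m) x = x ^ m * bessel_series (real m) x"
proof -
  let ?f = "\<lambda>j. rGamma (real j + 1 + - real m) / fact j * x ^ j"
  have low: "?f j = 0" if "j < m" for j
  proof -
    have "real j + 1 + - real m = - of_nat (m - 1 - j)"
      using that by simp
    then show ?thesis by (simp add: rGamma_eq_zero_iff del: of_nat_diff)
  qed
  have high: "?f (j + m) = x ^ m * (x ^ j / (fact j * fact (m + j)))" for j
  proof -
    have "real (j + m) + 1 + - real m = 1 + of_nat j" by simp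
    then have "rGamma (real (j + m) + 1 + - real m) = inverse (fact j)"
      by (simp only: rGamma_inverse_Gamma Gamma_fact)
    then show ?thesis by (simp add: divide_inverse power_add add.commute mult_ac)
  qed
  have "(\<lambda>j. ?f (j + m)) sums (x ^ m * bessel_series (real m) x)"
    unfolding high by (intro sums_mult bessel_series_nat_sums)
  then have "?f sums (x ^ m * bessel_series (real m) x + (\<Sum>j<m. ?f j))"
    by (rule sums_iff_shift[THEN iffD1])
  moreover have "(\<Sum>j<m. ?f j) = 0"
    using low by (intro sum.neutral) blast
  ultimately have "?f sums (x ^ m * bessel_series (real m) x)" by simp
  then show ?thesis
    using bessel_series_sums[of "- real m" x] sums_unique2 by blast
qed

lemma sin_pi_quotient_tendsto:
  "((\<lambda>\<mu>. (\<mu> - real m) * pi / sin (pi * \<mu>)) \<longlongrightarrow> (- 1) ^ m) (at (real m))"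
proof -
  have "((\<lambda>\<mu>. sin (pi * \<mu>)) has_real_derivative pi * (- 1) ^ m) (at (real m))"
    by (auto intro!: derivative_eq_intros simp: mult.commute)
  then have "((\<lambda>\<mu>. sin (pi * \<mu>) / (\<mu> - real m)) \<longlongrightarrow> pi * (- 1) ^ m) (at (real m))"
    by (simp add: has_field_derivative_iff mult.commute)
  then have "((\<lambda>\<mu>. pi / (sin (pi * \<mu>) / (\<mu> - real m))) \<longlongrightarrow> pi / (pi * (- 1) ^ m)) (at (real m))"
    by (intro tendsto_divide tendsto_const) auto
  then show ?thesis by (simp add: mult.commute power_divide flip: power_one_over)
qed

text \<open>A quotient of type 0/0 at \<mu> = m: the numerator contributes its derivative L and the
  sine its derivative pi (-1)^m. Continuity of the integral in \<mu> identifies the limit with the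
  value at m.\<close>

lemma bessel_integral_nat_eq_deriv:
  assumes x: "x > 0"
    and N: "((\<lambda>\<mu>. x powr (- \<mu>) * bessel_series (- \<mu>) x - bessel_series \<mu> x) has_real_derivative L) (at (real m))"
  shows "bessel_integral (real m) x = (- 1) ^ m * L"
proof -
  let ?N = "\<lambda>\<mu>. x powr (- \<mu>) * bessel_series (- \<mu>) x - bessel_series \<mu> x"
  have N0: "?N (real m) = 0"
    using x by (simp add: bessel_series_minus_nat powr_minus powr_realpow)
  have "((\<lambda>\<mu>. ?N \<mu> / (\<mu> - real m)) \<longlongrightarrow> L) (at (real m))"
    using N unfolding has_field_derivative_iff N0 by simp
  from tendsto_mult[OF sin_pi_quotient_tendsto this]
  have "((\<lambda>\<mu>. (\<mu> - real m) * pi / sin (pi * \<mu>) * (?N \<mu> / (\<mu> - real m))) \<longlongrightarrow> (- 1) ^ m * L) (at (real m))" .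
  moreover have "\<forall>\<^sub>F \<mu> in at (real m). (\<mu> - real m) * pi / sin (pi * \<mu>) * (?N \<mu> / (\<mu> - real m)) = bessel_integral \<mu> x"
    unfolding eventually_at
  \<comment> \<open>No integer other than m lies within distance 1 of m, so the noninteger formula
    holds on the whole punctured neighbourhood.\<close>
  proof (intro exI[of _ 1] conjI ballI impI)
    fix \<mu> :: real assume \<mu>: "\<mu> \<noteq> real m \<and> dist \<mu> (real m) < 1"
    have "\<mu> \<notin> \<int>"
    proof
      assume "\<mu> \<in> \<int>"
      then obtain k where "\<mu> = of_int k" by (elim Ints_cases)
      then have "\<bar>real_of_int (k - int m)\<bar> < 1" "k \<noteq> int m" using \<mu> by (auto simp: dist_real_def)
      then show False by linarith
    qed
    then show "(\<mu> - real m) * pi / sin (pi * \<mu>) * (?N \<mu> / (\<mu> - real m)) = bessel_integral \<mu> x"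
      using \<mu> x by (simp add: bessel_integral_nonint bessel_combination_def)
  qed simp
  ultimately have "((\<lambda>\<mu>. bessel_integral \<mu> x) \<longlongrightarrow> (- 1) ^ m * L) (at (real m))"
    by (rule Lim_transform_eventually)
  moreover have "((\<lambda>\<mu>. bessel_integral \<mu> x) \<longlongrightarrow> bessel_integral (real m) x) (at (real m))"
    using isCont_bessel_integral_index[OF x] by (simp add: isCont_def)
  ultimately show ?thesis
    by (intro tendsto_unique[of "at (real m)"]) auto
qed

text \<open>The logarithm comes from differentiating \<open>x powr (- \<mu>)\<close>, and the two
  digamma terms from the two series. Solving for the infinite series, with \<open>sums\<close>,
  delivers its convergence along with its value.\<close>

lemma bessel_integral_nat:
  assumes x: "x > 0"
  shows "(\<lambda>j. x ^ j / (fact j * fact (m + j)) * (ln x - Digamma (real j + 1) - Digamma (real (m + j) + 1)))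
      sums ((- 1) ^ (m + 1) * (bessel_integral (real m) x - (\<Sum>j<m. (- 1) ^ j * (fact (m - j - 1) / fact j) * (x ^ j / x ^ m))))"
proof -
  obtain L1 where L1: "((\<lambda>\<mu>. bessel_series \<mu> x) has_real_derivative L1) (at (real m))"
      "(\<lambda>j. rGamma_deriv (real j + 1 + real m) / fact j * x ^ j) sums L1"
    using bessel_series_has_index_derivative .
  obtain L2 where L2: "((\<lambda>\<mu>. bessel_series \<mu> x) has_real_derivative L2) (at (- real m))"
      "(\<lambda>j. rGamma_deriv (real j + 1 + - real m) / fact j * x ^ j) sums L2"
    using bessel_series_has_index_derivative .
  let ?S = "bessel_series (real m) x"
  \<comment> \<open>The first m terms of \<open>L2\<close>: there 1/Gamma is differentiated at its
    zeros -(m - 1 - j), which produces factorials instead of digamma values.\<close>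
  let ?P = "\<Sum>j<m. (- 1) ^ (m - 1 - j) * fact (m - 1 - j) / fact j * x ^ j"
  have pos: "rGamma_deriv (real (Suc k)) = - (inverse (fact k) * Digamma (real k + 1))" for k
  proof -
    have "real (Suc k) \<notin> \<int>\<^sub>\<le>\<^sub>0" by (metis nonpos_Ints_nonpos not_le of_nat_0_less_iff zero_less_Suc)
    moreover have "rGamma (real (Suc k)) = inverse (fact k)"
      by (simp add: rGamma_inverse_Gamma Gamma_fact)
    ultimately show ?thesis by (simp add: rGamma_deriv_def add.commute)
  qed
  have neg: "rGamma_deriv (- real k) = (- 1) ^ k * fact k" for k
    by (simp add: rGamma_deriv_def)
  have "((\<lambda>\<mu>. x powr (- \<mu>) * bessel_series (- \<mu>) x - bessel_series \<mu> x) has_real_derivative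
      - ln x * ?S - L2 / x ^ m - L1) (at (real m))"
  proof -
    have "((\<lambda>\<mu>. bessel_series (- \<mu>) x) has_real_derivative L2 * (- 1)) (at (real m))"
      by (rule DERIV_chain2[where g = uminus, OF L2(1)]) (auto intro!: derivative_eq_intros)
    moreover have "((\<lambda>\<mu>. x powr (- \<mu>)) has_real_derivative - ln x * x powr (- real m)) (at (real m))"
      using x by (auto intro!: derivative_eq_intros)
    ultimately have "((\<lambda>\<mu>. x powr (- \<mu>) * bessel_series (- \<mu>) x - bessel_series \<mu> x) has_real_derivative
      (- ln x * x powr (- real m)) * bessel_series (- real m) x + L2 * (- 1) * x powr (- real m) - L1) (at (real m))"
      by (intro DERIV_diff DERIV_mult L1)
    moreover have "x powr (- real m) = inverse (x ^ m)"
      using x by (simp add: powr_minus powr_realpow)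
    moreover have "inverse (x ^ m) * (x ^ m * ?S) = ?S"
      using x by simp
    ultimately show ?thesis
      by (simp add: bessel_series_minus_nat divide_inverse mult.assoc)
  qed
  then have F: "bessel_integral (real m) x = (- 1) ^ m * (- ln x * ?S - L2 / x ^ m - L1)"
    by (rule bessel_integral_nat_eq_deriv[OF x])
  have 1: "(\<lambda>j. - (x ^ j / (fact j * fact (m + j)) * Digamma (real (m + j) + 1))) sums L1"
  proof -
    have "real j + 1 + real m = real (Suc (m + j))" for j by simp
    then show ?thesis using L1(2) by (simp only: pos) (simp add: divide_inverse mult_ac)
  qed
  have 2: "(\<lambda>j. - (x ^ j / (fact j * fact (m + j)) * Digamma (real j + 1))) sums ((L2 - ?P) / x ^ m)"
  proof -
    let ?f = "\<lambda>j. rGamma_deriv (real j + 1 + - real m) / fact j * x ^ j"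
    have low: "?f j = (- 1) ^ (m - 1 - j) * fact (m - 1 - j) / fact j * x ^ j" if "j < m" for j
    proof -
      have "real j + 1 + - real m = - real (m - 1 - j)" using that by simp
      then show ?thesis by (simp only: neg)
    qed
    have high: "?f (j + m) / x ^ m = - (x ^ j / (fact j * fact (m + j)) * Digamma (real j + 1))" for j
    proof -
      have "real (j + m) + 1 + - real m = real (Suc j)" by simp
      then have "?f (j + m) = - (inverse (fact j) * Digamma (real j + 1)) / fact (j + m) * x ^ (j + m)"
        by (simp only: pos)
      then show ?thesis using x by (simp add: power_add divide_inverse add.commute mult_ac)
    qed
    have "(\<lambda>j. ?f (j + m)) sums (L2 - (\<Sum>j<m. ?f j))"
      by (rule sums_split_initial_segment[OF L2(2)])
    then have "(\<lambda>j. ?f (j + m) / x ^ m) sums ((L2 - (\<Sum>j<m. ?f j)) / x ^ m)"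
      by (rule sums_divide)
    moreover have "(\<Sum>j<m. ?f j) = ?P" by (intro sum.cong refl low) simp
    ultimately show ?thesis unfolding high by simp
  qed
  have "(\<lambda>j. ln x * (x ^ j / (fact j * fact (m + j)))
        + - (x ^ j / (fact j * fact (m + j)) * Digamma (real j + 1))
        + - (x ^ j / (fact j * fact (m + j)) * Digamma (real (m + j) + 1)))
      sums (ln x * ?S + (L2 - ?P) / x ^ m + L1)"
    by (intro sums_add sums_mult bessel_series_nat_sums 1 2)
  moreover have "ln x * ?S + (L2 - ?P) / x ^ m + L1 = (- 1) ^ (m + 1) *
      (bessel_integral (real m) x - (\<Sum>j<m. (- 1) ^ j * (fact (m - j - 1) / fact j) * (x ^ j / x ^ m)))"
  proof -
    \<comment> \<open>The exponents m + 1 + j and m - 1 - j differ by the even number 2j +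
      2.\<close>
    have sgn: "(- 1) ^ (m + 1) * (- 1) ^ j = (- 1 :: real) ^ (m - 1 - j)" if "j < m" for j
    proof -
      obtain k where "m = Suc (j + k)" using less_imp_Suc_add[OF \<open>j < m\<close>] by blast
      then show ?thesis by (simp add: minus_one_power_iff)
    qed
    have "(- 1) ^ (m + 1) * (\<Sum>j<m. (- 1) ^ j * (fact (m - j - 1) / fact j) * (x ^ j / x ^ m)) = ?P / x ^ m"
      unfolding sum_distrib_left sum_divide_distrib
    proof (intro sum.cong refl)
      fix j assume "j \<in> {..<m}"
      then have "(- 1) ^ (m + 1) * (- 1) ^ j = (- 1 :: real) ^ (m - 1 - j)" by (intro sgn) simp
      then show "(- 1) ^ (m + 1) * ((- 1) ^ j * (fact (m - j - 1) / fact j) * (x ^ j / x ^ m))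
          = (- 1) ^ (m - 1 - j) * fact (m - 1 - j) / fact j * x ^ j / x ^ m"
        by (simp add: mult.assoc[symmetric] diff_right_commute)
    qed
    moreover have "(- 1) ^ (m + 1) * bessel_integral (real m) x = ln x * ?S + L2 / x ^ m + L1"
    proof -
      have "(- 1) ^ (m + 1) * ((- 1) ^ m * y) = - y" for y :: real
        by (simp add: minus_one_power_iff)
      then show ?thesis unfolding F by (simp only:)
    qed
    ultimately show ?thesis by (simp add: right_diff_distrib diff_divide_distrib)
  qed
  moreover have "ln x * (x ^ j / (fact j * fact (m + j)))
        + - (x ^ j / (fact j * fact (m + j)) * Digamma (real j + 1))
        + - (x ^ j / (fact j * fact (m + j)) * Digamma (real (m + j) + 1))
      = x ^ j / (fact j * fact (m + j)) * (ln x - Digamma (real j + 1) - Digamma (real (m + j) + 1))" for j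
    by (simp only: right_diff_distrib) simp
  ultimately show ?thesis by (simp only:)
qed

section \<open>Gaussian Fourier transforms and uniqueness of densities\<close>

text \<open>\<open>lborel\<close> is the image of the product of one-dimensional Lebesgue measures
  under the coordinate map \<open>?T\<close>, so the integral of a product of functions of single
  coordinates factors.\<close>

lemma
  fixes \<phi> :: "'a::euclidean_space \<Rightarrow> real \<Rightarrow> complex"
  assumes \<phi>: "\<And>b. b \<in> Basis \<Longrightarrow> integrable lborel (\<phi> b)"
  shows integrable_lborel_prod: "integrable lborel (\<lambda>x::'a. \<Prod>b\<in>Basis. \<phi> b (x \<bullet> b))"
    and integral_lborel_prod: "(LINT x|lborel. (\<Prod>b\<in>Basis. \<phi> b (x \<bullet> b))) = (\<Prod>b\<in>Basis. (LINT y|lborel. \<phi> b y))"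
proof -
  interpret product_sigma_finite "\<lambda>_::'a. lborel :: real measure" ..
  have [measurable]: "b \<in> Basis \<Longrightarrow> \<phi> b \<in> borel_measurable borel" for b
    using borel_measurable_integrable[OF \<phi>] by simp
  let ?T = "\<lambda>f. \<Sum>b\<in>Basis. f b *\<^sub>R b :: 'a"
  have [measurable]: "?T \<in> borel_measurable (\<Pi>\<^sub>M b\<in>Basis. lborel)"
    by measurable
  have m: "(\<lambda>x::'a. \<Prod>b\<in>Basis. \<phi> b (x \<bullet> b)) \<in> borel_measurable borel"
    by measurable
  have eq: "(\<Prod>b\<in>Basis. \<phi> b (?T f \<bullet> b)) = (\<Prod>b\<in>Basis. \<phi> b (f b))" for f
    by (intro prod.cong refl) simp
  show "integrable lborel (\<lambda>x::'a. \<Prod>b\<in>Basis. \<phi> b (x \<bullet> b))"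
    unfolding lborel_eq[where 'a='a] using m
    by (subst integrable_distr_eq) (simp_all only: eq \<phi> product_integrable_prod finite_Basis \<open>?T \<in> _\<close>)
  show "(LINT x|lborel. (\<Prod>b\<in>Basis. \<phi> b (x \<bullet> b))) = (\<Prod>b\<in>Basis. (LINT y|lborel. \<phi> b y))"
    unfolding lborel_eq[where 'a='a] using m
    by (subst integral_distr) (simp_all only: eq \<phi> product_integral_prod finite_Basis \<open>?T \<in> _\<close>)
qed

text \<open>For s > 0 this is the density of the centred normal law with covariance 2s times the
  identity; with this scaling its characteristic function is
  \<open>exp (- s * (norm t)\<^sup>2)\<close>.\<close>

definition heat_kernel :: "real \<Rightarrow> 'a::euclidean_space \<Rightarrow> real" where
  "heat_kernel s x = exp (- (norm x)\<^sup>2 / (4 * s)) / (4 * pi * s) powr (real DIM('a) / 2)"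

lemma heat_kernel_nonneg: "heat_kernel s x \<ge> 0"
  unfolding heat_kernel_def by (intro divide_nonneg_nonneg) simp_all

lemma heat_kernel_prod:
  fixes x :: "'a::euclidean_space"
  assumes "s > 0"
  shows "heat_kernel s x = (\<Prod>b\<in>Basis. normal_density 0 (sqrt (2 * s)) (x \<bullet> b))"
proof -
  have "sqrt (4 * pi * s) ^ DIM('a) = (4 * pi * s) powr (real DIM('a) / 2)"
    using assms by (simp add: powr_half_sqrt[symmetric] powr_realpow[symmetric] powr_powr)
  moreover have "(\<Prod>b\<in>Basis. exp (- (x \<bullet> b)\<^sup>2 / (4 * s))) = exp (- (norm x)\<^sup>2 / (4 * s))"
    unfolding exp_sum[OF finite_Basis, symmetric] power2_norm_eq_inner euclidean_inner[of x x]
    by (simp add: sum_negf sum_divide_distrib power2_eq_square)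
  moreover have "normal_density 0 (sqrt (2 * s)) y = exp (- y\<^sup>2 / (4 * s)) / sqrt (4 * pi * s)" for y
    using assms by (simp add: normal_density_def mult_ac)
  ultimately show ?thesis
    by (simp only: heat_kernel_def prod_dividef prod_constant)
qed

lemma
  assumes s: "s > 0"
  shows integrable_normal_iexp: "integrable lborel (\<lambda>y. iexp (y * t) * complex_of_real (normal_density 0 (sqrt (2 * s)) y))"
    and integral_normal_iexp: "(LINT y|lborel. iexp (y * t) * complex_of_real (normal_density 0 (sqrt (2 * s)) y)) = of_real (exp (- s * t\<^sup>2))"
proof -
  have "integrable lborel (\<lambda>y. complex_of_real (normal_density 0 (sqrt (2 * s)) y))"
    by (intro integrable_of_real integrable_normal_density) (use s in simp)
  then show "integrable lborel (\<lambda>y. iexp (y * t) * complex_of_real (normal_density 0 (sqrt (2 * s)) y))"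
    by (rule Bochner_Integration.integrable_bound) (auto simp: norm_mult)
  let ?\<sigma> = "sqrt (2 * s)"
  have "of_real (exp (- (?\<sigma> * t)\<^sup>2 / 2)) = char std_normal_distribution (?\<sigma> * t)"
    by (simp add: char_std_normal_distribution)
  also have "\<dots> = (LINT y|lborel. std_normal_density y *\<^sub>R iexp (?\<sigma> * t * y))"
    unfolding char_def by (subst integral_density) auto
  also have "\<dots> = \<bar>1 / ?\<sigma>\<bar> *\<^sub>R (LINT y|lborel. std_normal_density (0 + 1 / ?\<sigma> * y) *\<^sub>R iexp (?\<sigma> * t * (0 + 1 / ?\<sigma> * y)))"
    using s by (intro lborel_integral_real_affine) simp
  also have "\<dots> = (LINT y|lborel. (1 / ?\<sigma>) *\<^sub>R (std_normal_density (0 + 1 / ?\<sigma> * y) *\<^sub>R iexp (?\<sigma> * t * (0 + 1 / ?\<sigma> * y))))"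
    using s by (simp only: integral_scaleR_right abs_of_pos zero_less_divide_1_iff real_sqrt_gt_0_iff zero_less_mult_iff) simp
  also have "\<dots> = (LINT y|lborel. iexp (y * t) * complex_of_real (normal_density 0 (sqrt (2 * s)) y))"
  proof (rule Bochner_Integration.integral_cong)
    fix y :: real
    have "1 / ?\<sigma> * std_normal_density (0 + 1 / ?\<sigma> * y) = normal_density 0 ?\<sigma> y"
      using s by (simp add: normal_density_def power_divide real_sqrt_mult mult_ac)
    moreover have "?\<sigma> * t * (0 + 1 / ?\<sigma> * y) = y * t" using s by simp
    ultimately show "(1 / ?\<sigma>) *\<^sub>R (std_normal_density (0 + 1 / ?\<sigma> * y) *\<^sub>R iexp (?\<sigma> * t * (0 + 1 / ?\<sigma> * y)))
        = iexp (y * t) * complex_of_real (normal_density 0 ?\<sigma> y)"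
      by (simp only: scaleR_scaleR) (simp add: scaleR_conv_of_real mult.commute)
  qed simp
  finally show "(LINT y|lborel. iexp (y * t) * complex_of_real (normal_density 0 (sqrt (2 * s)) y)) = of_real (exp (- s * t\<^sup>2))"
    using s by (simp add: power_mult_distrib)
qed

lemma
  fixes t :: "'a::euclidean_space"
  assumes s: "s > 0"
  shows integrable_heat_kernel_iexp: "integrable lborel (\<lambda>x. iexp (x \<bullet> t) * complex_of_real (heat_kernel s x))"
    and integral_heat_kernel_iexp: "(LINT x|lborel. iexp (x \<bullet> t) * complex_of_real (heat_kernel s x)) = of_real (exp (- s * (norm t)\<^sup>2))"
proof -
  have eq: "iexp (x \<bullet> t) * complex_of_real (heat_kernel s x)
      = (\<Prod>b\<in>Basis. iexp ((x \<bullet> b) * (t \<bullet> b)) * complex_of_real (normal_density 0 (sqrt (2 * s)) (x \<bullet> b)))" for x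
    unfolding heat_kernel_prod[OF s] euclidean_inner[of x t]
    by (simp add: prod.distrib exp_sum sum_distrib_left)
  show "integrable lborel (\<lambda>x. iexp (x \<bullet> t) * complex_of_real (heat_kernel s x))"
    unfolding eq by (rule integrable_lborel_prod[OF integrable_normal_iexp[OF s]])
  have "(\<Prod>b\<in>Basis. exp (- s * (t \<bullet> b)\<^sup>2)) = exp (- s * (norm t)\<^sup>2)"
    unfolding exp_sum[OF finite_Basis, symmetric] power2_norm_eq_inner euclidean_inner[of t t]
    by (simp add: sum_negf sum_distrib_left power2_eq_square)
  then show "(LINT x|lborel. iexp (x \<bullet> t) * complex_of_real (heat_kernel s x)) = of_real (exp (- s * (norm t)\<^sup>2))"
    unfolding eq integral_lborel_prod[OF integrable_normal_iexp[OF s]] integral_normal_iexp[OF s] by (simp flip: of_real_prod)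
qed

lemma integral_heat_kernel:
  assumes s: "s > 0"
  shows "(LINT x::'a::euclidean_space|lborel. heat_kernel s x) = 1"
proof -
  have "complex_of_real (LINT x::'a|lborel. heat_kernel s x) = 1"
    using integral_heat_kernel_iexp[OF s, of "0::'a"] by simp
  then show ?thesis
    by (simp only: of_real_eq_1_iff)
qed

text \<open>The Gaussian is itself a Fourier transform, so the convolution of \<open>d\<close> with it only depends on the
  Fourier transform of \<open>d\<close>.\<close>

lemma gaussian_smoothing_zero:
  fixes d :: "'a::euclidean_space \<Rightarrow> real"
  assumes d: "integrable lborel d"
    and char: "\<And>t. (LINT x|lborel. iexp (x \<bullet> t) * complex_of_real (d x)) = 0"
    and s: "s > 0"
  shows "(LINT y|lborel. d y * exp (- s * (norm (y - z))\<^sup>2)) = 0"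
proof -
  have [measurable]: "d \<in> borel_measurable borel" using borel_measurable_integrable[OF d] by simp
  have [measurable]: "(heat_kernel s :: 'a \<Rightarrow> real) \<in> borel_measurable borel"
    unfolding heat_kernel_def by measurable
  \<comment> \<open>Integrating over u first reproduces the Gaussian factor centred at z;
    integrating over y first exposes the Fourier transform of \<open>d\<close> at u, which is
    zero.\<close>
  let ?F = "\<lambda>y u. complex_of_real (d y) * (iexp (u \<bullet> (y - z)) * complex_of_real (heat_kernel s u))"
  have nF: "norm (?F y u) = \<bar>d y\<bar> * heat_kernel s u" for y u
    by (simp add: norm_mult heat_kernel_nonneg)
  have "integrable (lborel \<Otimes>\<^sub>M lborel) (case_prod ?F)"
  proof (rule lborel_pair.Fubini_integrable)
    show "case_prod ?F \<in> borel_measurable (lborel \<Otimes>\<^sub>M lborel)" by measurable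
    show "integrable lborel (\<lambda>y. LINT u|lborel. norm (case (y, u) of (y, u) \<Rightarrow> ?F y u))"
      using d by (simp add: nF integral_heat_kernel[OF s])
    show "AE y in lborel. integrable lborel (\<lambda>u. case (y, u) of (y, u) \<Rightarrow> ?F y u)"
      unfolding prod.case by (intro AE_I2 integrable_mult_right integrable_heat_kernel_iexp[OF s])
  qed
  then have "(LINT u|lborel. (LINT y|lborel. ?F y u)) = (LINT y|lborel. (LINT u|lborel. ?F y u))"
    by (rule lborel_pair.Fubini_integral)
  also have "\<dots> = (LINT y|lborel. complex_of_real (d y * exp (- s * (norm (y - z))\<^sup>2)))"
    by (simp only: integral_mult_right_zero integral_heat_kernel_iexp[OF s] of_real_mult)
  also have "\<dots> = complex_of_real (LINT y|lborel. d y * exp (- s * (norm (y - z))\<^sup>2))"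
    by (rule integral_complex_of_real)
  also have "(LINT u|lborel. (LINT y|lborel. ?F y u)) = (LINT u|lborel. iexp (- (u \<bullet> z)) * complex_of_real (heat_kernel s u) * (LINT y|lborel. iexp (y \<bullet> u) * complex_of_real (d y)))"
  proof (rule Bochner_Integration.integral_cong)
    fix u :: 'a
    have "?F y u = iexp (- (u \<bullet> z)) * complex_of_real (heat_kernel s u) * (iexp (y \<bullet> u) * complex_of_real (d y))" for y
    proof -
      have "iexp (u \<bullet> (y - z)) = iexp (- (u \<bullet> z)) * iexp (y \<bullet> u)"
        by (simp add: inner_diff_right inner_commute algebra_simps flip: exp_add)
      then show ?thesis by (simp only: mult_ac)
    qed
    then show "(LINT y|lborel. ?F y u) = iexp (- (u \<bullet> z)) * complex_of_real (heat_kernel s u) * (LINT y|lborel. iexp (y \<bullet> u) * complex_of_real (d y))"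
      by (simp only: integral_mult_right_zero)
  qed simp
  also have "\<dots> = 0" by (simp only: char mult_zero_right Bochner_Integration.integral_zero)
  finally show ?thesis by simp
qed

text \<open>For large s the Gaussian concentrates at z. If \<open>d z\<close> were positive, the
  ball of radius \<delta>/2 would contribute at least a constant times exp(-s \<delta>^2/4), while
  the loss outside radius \<delta> is at most exp(-s \<delta>^2) times the integral of |d|. The gap
  1 - 1/4 in the exponents yields the rate 3/4.\<close>

lemma nonpos_of_gaussian_smoothing:
  fixes d :: "'a::euclidean_space \<Rightarrow> real"
  assumes d: "integrable lborel d" and cont: "isCont d z"
    and zero: "\<And>s. s > 0 \<Longrightarrow> (LINT y|lborel. d y * exp (- s * (norm (y - z))\<^sup>2)) = 0"
  shows "d z \<le> 0"
proof (rule ccontr)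
  assume "\<not> d z \<le> 0"
  define c where "c = d z / 2"
  have c: "c > 0" using \<open>\<not> d z \<le> 0\<close> by (simp add: c_def)
  obtain \<delta> where \<delta>: "\<delta> > 0" "\<And>y. dist y z < \<delta> \<Longrightarrow> dist (d y) (d z) < c"
    using cont c unfolding continuous_at_eps_delta by blast
  have dc: "c \<le> d y" if "norm (y - z) < \<delta>" for y
    using \<delta>(2)[of y] that unfolding dist_norm c_def real_norm_def by linarith
  let ?V = "measure lborel (ball z (\<delta> / 2))" and ?I = "LINT y|lborel. \<bar>d y\<bar>"
  have V: "?V > 0"
    using \<delta>(1) by (intro content_ball_pos) auto
  have [measurable]: "d \<in> borel_measurable borel" using borel_measurable_integrable[OF d] by simp
  have ineq: "c * ?V \<le> exp (- (3 * \<delta>\<^sup>2 / 4 * s)) * ?I" if s: "s > 0" for s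
  proof -
    \<comment> \<open>An integrable lower bound that needs no splitting of the domain: between the
      two radii \<open>d\<close> is positive, so dropping its contribution is harmless
      there.\<close>
    let ?lo = "\<lambda>y. c * exp (- s * (\<delta> / 2)\<^sup>2) * indicator (ball z (\<delta> / 2)) y - exp (- s * \<delta>\<^sup>2) * \<bar>d y\<bar>"
    have pw: "?lo y \<le> d y * exp (- s * (norm (y - z))\<^sup>2)" for y
    proof (cases "norm (y - z) < \<delta>")
      case True
      have "c * exp (- s * (\<delta> / 2)\<^sup>2) * indicator (ball z (\<delta> / 2)) y \<le> d y * exp (- s * (norm (y - z))\<^sup>2)"
      proof (cases "y \<in> ball z (\<delta> / 2)")
        case True
        then have "(norm (y - z))\<^sup>2 \<le> (\<delta> / 2)\<^sup>2"
          by (intro power_mono) (auto simp: dist_norm norm_minus_commute)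
        then have "exp (- s * (\<delta> / 2)\<^sup>2) \<le> exp (- s * (norm (y - z))\<^sup>2)" using s by simp
        then show ?thesis
          using True dc[OF \<open>norm (y - z) < \<delta>\<close>] c by (auto intro!: mult_mono)
      next
        case False
        then show ?thesis using dc[OF \<open>norm (y - z) < \<delta>\<close>] c by simp
      qed
      moreover have "0 \<le> exp (- s * \<delta>\<^sup>2) * \<bar>d y\<bar>" by simp
      ultimately show ?thesis by linarith
    next
      case False
      then have "y \<notin> ball z (\<delta> / 2)" using \<delta>(1) by (auto simp: dist_norm norm_minus_commute)
      moreover have "exp (- s * (norm (y - z))\<^sup>2) \<le> exp (- s * \<delta>\<^sup>2)"
        using False s \<delta>(1) by (auto intro!: power_mono)
      then have "\<bar>d y\<bar> * exp (- s * (norm (y - z))\<^sup>2) \<le> \<bar>d y\<bar> * exp (- s * \<delta>\<^sup>2)"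
        by (intro mult_left_mono) auto
      moreover have "- (\<bar>d y\<bar> * exp (- s * (norm (y - z))\<^sup>2)) \<le> d y * exp (- s * (norm (y - z))\<^sup>2)"
        using mult_right_mono[of "- \<bar>d y\<bar>" "d y" "exp (- s * (norm (y - z))\<^sup>2)"] by simp
      ultimately show ?thesis by (simp add: mult.commute)
    qed
    have i1: "integrable lborel (\<lambda>y. c * exp (- s * (\<delta> / 2)\<^sup>2) * indicator (ball z (\<delta> / 2)) y)"
      by (intro integrable_mult_right integrable_real_indicator) (use emeasure_bounded_finite[of "ball z (\<delta> / 2)"] in auto)
    have i2: "integrable lborel (\<lambda>y. exp (- s * \<delta>\<^sup>2) * \<bar>d y\<bar>)"
      using d by (intro integrable_mult_right integrable_abs)
    have i3: "integrable lborel (\<lambda>y. d y * exp (- s * (norm (y - z))\<^sup>2))"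
      by (rule Bochner_Integration.integrable_bound[OF d]) (use s in \<open>auto simp: abs_mult intro!: mult_left_le\<close>)
    have "(LINT y|lborel. ?lo y) \<le> (LINT y|lborel. d y * exp (- s * (norm (y - z))\<^sup>2))"
      by (intro integral_mono Bochner_Integration.integrable_diff i1 i2 i3 pw)
    then have "(LINT y|lborel. ?lo y) \<le> 0" using zero[OF s] by simp
    moreover have "(LINT y|lborel. ?lo y) = c * exp (- s * (\<delta> / 2)\<^sup>2) * ?V - exp (- s * \<delta>\<^sup>2) * ?I"
      using i1 i2 by (subst Bochner_Integration.integral_diff) auto
    ultimately have "exp (s * (\<delta> / 2)\<^sup>2) * (c * exp (- s * (\<delta> / 2)\<^sup>2) * ?V) \<le> exp (s * (\<delta> / 2)\<^sup>2) * (exp (- s * \<delta>\<^sup>2) * ?I)"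
      by (intro mult_left_mono) auto
    moreover have "exp (s * (\<delta> / 2)\<^sup>2) * (c * exp (- s * (\<delta> / 2)\<^sup>2) * ?V) = c * ?V"
      by (simp add: exp_minus)
    moreover have "exp (s * (\<delta> / 2)\<^sup>2) * exp (- s * \<delta>\<^sup>2) = exp (- (3 * \<delta>\<^sup>2 / 4 * s))"
      by (simp add: power_divide field_simps flip: exp_add)
    ultimately show ?thesis by (simp only: mult.assoc[symmetric])
  qed
  have "0 < 3 * \<delta>\<^sup>2 / 4" using \<delta>(1) by simp
  then have "((\<lambda>s. exp (- (3 * \<delta>\<^sup>2 / 4 * s))) \<longlongrightarrow> 0) at_top"
    by real_asymp
  then have "((\<lambda>s. exp (- (3 * \<delta>\<^sup>2 / 4 * s)) * ?I) \<longlongrightarrow> 0) at_top"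
    by (rule tendsto_mult_left_zero)
  moreover have "\<forall>\<^sub>F s in at_top. c * ?V \<le> exp (- (3 * \<delta>\<^sup>2 / 4 * s)) * ?I"
    using eventually_gt_at_top[of "0::real"] by eventually_elim (rule ineq)
  ultimately have "c * ?V \<le> 0"
    by (rule tendsto_lowerbound) simp
  then show False using c V by (simp add: mult_le_0_iff)
qed

lemma density_eq_of_char_eq:
  fixes f g :: "'a::euclidean_space \<Rightarrow> real"
  assumes f: "integrable lborel f" "isCont f z" and g: "integrable lborel g" "isCont g z"
    and char: "\<And>t. (LINT x|lborel. iexp (x \<bullet> t) * complex_of_real (f x)) = (LINT x|lborel. iexp (x \<bullet> t) * complex_of_real (g x))"
  shows "f z = g z"
proof -
  \<comment> \<open>Stated for arbitrary \<open>f\<close> and \<open>g\<close> so that it can be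
    applied in both orders.\<close>
  have le: "f z \<le> g z"
    if f: "integrable lborel f" "isCont f z" and g: "integrable lborel g" "isCont g z"
    and char: "\<And>t. (LINT x|lborel. iexp (x \<bullet> t) * complex_of_real (f x)) = (LINT x|lborel. iexp (x \<bullet> t) * complex_of_real (g x))"
    for f g :: "'a \<Rightarrow> real"
  proof -
    have I: "integrable lborel (\<lambda>x. iexp (x \<bullet> t) * complex_of_real (h x))" if "integrable lborel h" for h :: "'a \<Rightarrow> real" and t
    proof (rule Bochner_Integration.integrable_bound[OF that])
      have [measurable]: "h \<in> borel_measurable borel" using borel_measurable_integrable[OF that] by simp
      show "(\<lambda>x. iexp (x \<bullet> t) * complex_of_real (h x)) \<in> borel_measurable lborel" by measurable
    qed (simp add: norm_mult)
    have "(LINT x|lborel. iexp (x \<bullet> t) * complex_of_real (f x - g x)) = 0" for t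
      using I[OF f(1), of t] I[OF g(1), of t] char[of t] by (simp add: right_diff_distrib)
    then have "f z - g z \<le> 0"
      using f g by (intro nonpos_of_gaussian_smoothing[of "\<lambda>x. f x - g x"] gaussian_smoothing_zero) (auto intro: continuous_diff)
    then show ?thesis by simp
  qed
  show ?thesis
    using le[OF f g char] le[OF g f char[symmetric]] by simp
qed

section \<open>The density as a mixture of heat kernels\<close>

lemma set_integral_exp_powr_scaled:
  fixes a c :: real
  assumes a: "a > 0" and c: "c > 0"
  shows "(LINT s:{0<..}|lborel. s powr (a - 1) * exp (- (s * c))) = Gamma a * c powr (- a)"
proof -
  let ?f = "\<lambda>s. indicator {0<..} s *\<^sub>R (s powr (a - 1) * exp (- s))"
  let ?g = "\<lambda>s. indicator {0<..} s *\<^sub>R (s powr (a - 1) * exp (- (s * c)))"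
  have fg: "?f (0 + c * s) = c powr (a - 1) * ?g s" for s
    using c by (auto simp: indicator_def zero_less_mult_iff powr_mult mult_ac)
  have "Gamma a = (LINT s|lborel. ?f s)"
    using set_integrable_exp_powr(2)[OF a] by (simp add: set_lebesgue_integral_def)
  also have "\<dots> = \<bar>c\<bar> *\<^sub>R (LINT s|lborel. ?f (0 + c * s))"
    using c by (intro lborel_integral_real_affine) simp
  also have "\<dots> = c * (c powr (a - 1) * (LINT s|lborel. ?g s))"
    using c unfolding fg by simp
  also have "c * (c powr (a - 1) * (LINT s|lborel. ?g s)) = c powr a * (LINT s|lborel. ?g s)"
    using c by (simp add: powr_diff)
  finally show ?thesis
    using c by (simp add: set_lebesgue_integral_def powr_minus field_simps)
qed

text \<open>The kernel of the Bessel potential (1 - Laplacian)^(-\<nu>), up to its value at the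
  origin.\<close>

definition bessel_density :: "real \<Rightarrow> 'a::euclidean_space \<Rightarrow> real" where
  "bessel_density \<nu> x = bessel_integral (real DIM('a) / 2 - \<nu>) ((norm x)\<^sup>2 / 4) / (Gamma \<nu> * (4 * pi) powr (real DIM('a) / 2))"

text \<open>The density of the Gamma law of shape \<nu> and rate 1. Extending it by zero to the
  whole line lets Fubini be used with plain \<open>lborel\<close> in both variables.\<close>

definition gamma_weight :: "real \<Rightarrow> real \<Rightarrow> real" where
  "gamma_weight \<nu> s = indicator {0<..} s * (s powr (\<nu> - 1) * exp (- s) / Gamma \<nu>)"

lemma gamma_weight_measurable [measurable]: "gamma_weight \<nu> \<in> borel_measurable borel"
  unfolding gamma_weight_def[abs_def] by measurable

lemma gamma_weight_nonneg:
  assumes "\<nu> > 0"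
  shows "gamma_weight \<nu> s \<ge> 0"
proof -
  have "Gamma \<nu> \<ge> 0" using Gamma_real_pos[OF assms] by (rule less_imp_le)
  then show ?thesis
    unfolding gamma_weight_def by (rule mult_nonneg_nonneg[OF indicator_pos_le divide_nonneg_nonneg[OF mult_nonneg_nonneg[OF powr_ge_zero exp_ge_zero]]])
qed

lemma integrable_gamma_weight:
  assumes "\<nu> > 0"
  shows "integrable lborel (gamma_weight \<nu>)"
proof -
  have "integrable lborel (\<lambda>s. indicator {0<..} s *\<^sub>R (s powr (\<nu> - 1) * exp (- s)) / Gamma \<nu>)"
    by (rule integrable_divide) (rule set_integrable_exp_powr(1)[OF assms, unfolded set_integrable_def])
  then show ?thesis
    by (simp only: gamma_weight_def[abs_def] real_scaleR_def times_divide_eq_right)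
qed

text \<open>The integrands agree for every s, so the equality also holds at the origin, where both
  integrals may diverge and then take the default value 0.\<close>

lemma bessel_density_mixture:
  fixes x :: "'a::euclidean_space"
  shows "bessel_density \<nu> x = (LINT s|lborel. gamma_weight \<nu> s * heat_kernel s x)"
proof -
  let ?n = "real DIM('a)"
  have "gamma_weight \<nu> s * heat_kernel s x = (indicator {0<..} s *\<^sub>R
      (s powr (- (?n / 2 - \<nu>) - 1) * exp (- s - (norm x)\<^sup>2 / 4 / s))) / (Gamma \<nu> * (4 * pi) powr (?n / 2))" for s
  proof (cases "s > 0")
    case True
    have "(4 * pi * s) powr (?n / 2) = (4 * pi) powr (?n / 2) * s powr (?n / 2)"
      using True by (subst powr_mult) auto
    moreover have "s powr (- (?n / 2 - \<nu>) - 1) = s powr (\<nu> - 1) / s powr (?n / 2)"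
      by (simp add: algebra_simps flip: powr_diff)
    moreover have "exp (- s - (norm x)\<^sup>2 / 4 / s) = exp (- s) * exp (- (norm x)\<^sup>2 / (4 * s))"
      by (simp flip: exp_add)
    moreover have "indicator {0<..} s = (1::real)" using True by simp
    moreover have "1 * (w * e / g) * (e' / (p * q)) = (1 *\<^sub>R (w / q * (e * e'))) / (g * p)"
      for w e g e' p q :: real
      by (simp add: mult_ac)
    ultimately show ?thesis
      by (simp only: gamma_weight_def heat_kernel_def)
  qed (simp add: gamma_weight_def)
  then show ?thesis
    by (simp add: bessel_density_def bessel_integral_def set_lebesgue_integral_def)
qed

lemma bessel_density_nonneg: "\<nu> > 0 \<Longrightarrow> bessel_density \<nu> x \<ge> 0"
  unfolding bessel_density_mixture
  by (intro Bochner_Integration.integral_nonneg mult_nonneg_nonneg gamma_weight_nonneg heat_kernel_nonneg)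

text \<open>By Fubini the x-integral of each heat kernel gives exp(-s |t|^2), and the remaining
  s-integral is a Gamma integral with rate 1 + |t|^2. Absolute integrability is immediate because
  every heat kernel has mass 1.\<close>

lemma
  fixes t :: "'a::euclidean_space"
  assumes \<nu>: "\<nu> > 0"
  shows integrable_bessel_density_iexp: "integrable lborel (\<lambda>x. iexp (x \<bullet> t) * complex_of_real (bessel_density \<nu> x))"
    and integral_bessel_density_iexp: "(LINT x|lborel. iexp (x \<bullet> t) * complex_of_real (bessel_density \<nu> x))
      = of_real ((1 + (norm t)\<^sup>2) powr (- \<nu>))"
proof -
  let ?F = "\<lambda>s x. complex_of_real (gamma_weight \<nu> s) * (iexp (x \<bullet> t) * complex_of_real (heat_kernel s x))"
  have nF: "norm (?F s x) = gamma_weight \<nu> s * heat_kernel s x" for s x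
    by (simp add: norm_mult heat_kernel_nonneg gamma_weight_nonneg[OF \<nu>])
  have F0: "gamma_weight \<nu> s = 0" if "\<not> s > 0" for s
    using that by (simp add: gamma_weight_def)
  have I: "integrable (lborel \<Otimes>\<^sub>M lborel) (case_prod ?F)"
  proof (rule lborel_pair.Fubini_integrable)
    show "case_prod ?F \<in> borel_measurable (lborel \<Otimes>\<^sub>M lborel)"
      unfolding heat_kernel_def by measurable
    have "(LINT x|lborel. norm (case (s, x) of (s, x) \<Rightarrow> ?F s x)) = gamma_weight \<nu> s" for s
      by (cases "s > 0") (simp_all add: nF integral_heat_kernel F0)
    then show "integrable lborel (\<lambda>s. LINT x|lborel. norm (case (s, x) of (s, x) \<Rightarrow> ?F s x))"
      using integrable_gamma_weight[OF \<nu>] by (simp only:)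
    show "AE s in lborel. integrable lborel (\<lambda>x. case (s, x) of (s, x) \<Rightarrow> ?F s x)"
    proof (rule AE_I2)
      fix s show "integrable lborel (\<lambda>x. case (s, x) of (s, x) \<Rightarrow> ?F s x)"
        unfolding prod.case
        by (cases "s > 0") (simp_all only: F0 integrable_mult_right integrable_heat_kernel_iexp of_real_0 mult_zero_left integrable_zero simp_thms)
    qed
  qed
  have inner: "(LINT s|lborel. ?F s x) = iexp (x \<bullet> t) * complex_of_real (bessel_density \<nu> x)" for x
  proof -
    have "?F s x = iexp (x \<bullet> t) * complex_of_real (gamma_weight \<nu> s * heat_kernel s x)" for s
      by (simp add: mult_ac)
    then show ?thesis
      by (simp only: integral_mult_right_zero integral_complex_of_real bessel_density_mixture)
  qed
  show "integrable lborel (\<lambda>x. iexp (x \<bullet> t) * complex_of_real (bessel_density \<nu> x))"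
    using lborel_pair.integrable_snd[OF I] unfolding inner .
  have "(LINT x|lborel. iexp (x \<bullet> t) * complex_of_real (bessel_density \<nu> x)) = (LINT s|lborel. (LINT x|lborel. ?F s x))"
    using lborel_pair.Fubini_integral[OF I] unfolding inner .
  also have "\<dots> = (LINT s|lborel. complex_of_real (gamma_weight \<nu> s * exp (- s * (norm t)\<^sup>2)))"
  proof (rule Bochner_Integration.integral_cong)
    fix s show "(LINT x|lborel. ?F s x) = complex_of_real (gamma_weight \<nu> s * exp (- s * (norm t)\<^sup>2))"
      by (cases "s > 0") (simp_all only: integral_mult_right_zero integral_heat_kernel_iexp of_real_mult F0 of_real_0 mult_zero_left Bochner_Integration.integral_zero simp_thms)
  qed simp
  also have "\<dots> = complex_of_real (LINT s|lborel. gamma_weight \<nu> s * exp (- s * (norm t)\<^sup>2))"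
    by (rule integral_complex_of_real)
  also have "(LINT s|lborel. gamma_weight \<nu> s * exp (- s * (norm t)\<^sup>2)) =
      (LINT s:{0<..}|lborel. s powr (\<nu> - 1) * exp (- (s * (1 + (norm t)\<^sup>2)))) / Gamma \<nu>"
  proof -
    have "gamma_weight \<nu> s * exp (- s * (norm t)\<^sup>2) =
        (indicator {0<..} s *\<^sub>R (s powr (\<nu> - 1) * exp (- (s * (1 + (norm t)\<^sup>2))))) / Gamma \<nu>" for s
    proof -
      have "exp (- (s * (1 + (norm t)\<^sup>2))) = exp (- s) * exp (- s * (norm t)\<^sup>2)"
        by (simp add: algebra_simps flip: exp_add)
      then show ?thesis by (simp only: gamma_weight_def) simp
    qed
    then show ?thesis by (simp add: set_lebesgue_integral_def)
  qed
  also have "\<dots> = (1 + (norm t)\<^sup>2) powr (- \<nu>)"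
  proof -
    have "1 + (norm t)\<^sup>2 > 0" by (intro add_pos_nonneg) auto
    moreover have "Gamma \<nu> \<noteq> 0" using Gamma_real_pos[OF \<nu>] by simp
    ultimately show ?thesis using \<nu> by (simp add: set_integral_exp_powr_scaled)
  qed
  finally show "(LINT x|lborel. iexp (x \<bullet> t) * complex_of_real (bessel_density \<nu> x))
      = of_real ((1 + (norm t)\<^sup>2) powr (- \<nu>))" .
qed

lemma
  assumes \<nu>: "\<nu> > 0"
  shows integrable_bessel_density: "integrable lborel (bessel_density \<nu> :: 'a::euclidean_space \<Rightarrow> real)"
    and integral_bessel_density: "(LINT x::'a|lborel. bessel_density \<nu> x) = 1"
proof -
  have "integrable lborel (\<lambda>x::'a. complex_of_real (bessel_density \<nu> x))"
    using integrable_bessel_density_iexp[OF \<nu>, of "0::'a"] by simp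
  from integrable_Re[OF this] show "integrable lborel (bessel_density \<nu> :: 'a \<Rightarrow> real)"
    by simp
  have "complex_of_real (LINT x::'a|lborel. bessel_density \<nu> x) = 1"
    using integral_bessel_density_iexp[OF \<nu>, of "0::'a"] by simp
  then show "(LINT x::'a|lborel. bessel_density \<nu> x) = 1"
    by (simp only: of_real_eq_1_iff)
qed

lemma isCont_bessel_density:
  fixes x :: "'a::euclidean_space"
  assumes "x \<noteq> 0"
  shows "isCont (bessel_density \<nu>) x"
proof -
  have "isCont (\<lambda>x::'a. (norm x)\<^sup>2 / 4) x"
    by (intro continuous_intros) auto
  moreover have "isCont (bessel_integral \<mu>) ((norm x)\<^sup>2 / 4)" for \<mu>
    using assms by (intro DERIV_isCont[OF bessel_integral_has_derivative]) simp
  ultimately have "isCont (\<lambda>x::'a. bessel_integral \<mu> ((norm x)\<^sup>2 / 4)) x" for \<mu>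
    by (rule isCont_o2)
  then show ?thesis
    unfolding bessel_density_def[abs_def] divide_inverse[of "bessel_integral _ _"]
    by (intro continuous_mult continuous_const)
qed

section \<open>Identification of the chosen density and of its radial profile\<close>

lemma is_linnik_density_bessel_density:
  assumes \<nu>: "\<nu> > 0"
  shows "is_linnik_density 2 \<nu> (bessel_density \<nu> :: real ^ 'n::finite \<Rightarrow> real)"
  unfolding is_linnik_density_def
proof (intro conjI allI)
  note I = integrable_bessel_density[OF \<nu>, where 'a = "real ^ 'n"]
  show m: "(bessel_density \<nu> :: real ^ 'n \<Rightarrow> real) \<in> borel_measurable borel"
    using borel_measurable_integrable[OF I] by simp
  show "0 \<le> bessel_density \<nu> x" for x :: "real ^ 'n"
    by (rule bessel_density_nonneg[OF \<nu>])
  show "prob_space (density lborel (\<lambda>x::real ^ 'n. ennreal (bessel_density \<nu> x)))"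
  proof (rule prob_spaceI)
    have "emeasure (density lborel (\<lambda>x::real ^ 'n. ennreal (bessel_density \<nu> x))) UNIV
        = (\<integral>\<^sup>+x. ennreal (bessel_density \<nu> (x::real ^ 'n)) \<partial>lborel)"
      using m by (subst emeasure_density) auto
    also have "\<dots> = ennreal (LINT x|lborel. bessel_density \<nu> (x::real ^ 'n))"
      by (intro nn_integral_eq_integral I AE_I2 bessel_density_nonneg \<nu>)
    finally show "emeasure (density lborel (\<lambda>x::real ^ 'n. ennreal (bessel_density \<nu> x)))
        (space (density lborel (\<lambda>x::real ^ 'n. ennreal (bessel_density \<nu> x)))) = 1"
      by (simp add: integral_bessel_density[OF \<nu>])
  qed
  show "(LINT x|lborel. iexp (x \<bullet> t) * complex_of_real (bessel_density \<nu> x))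
      = complex_of_real ((1 + norm t powr 2) powr - \<nu>)" for t :: "real ^ 'n"
    using integral_bessel_density_iexp[OF \<nu>, of t] by simp
  show "continuous_on (UNIV - {0}) (bessel_density \<nu> :: real ^ 'n \<Rightarrow> real)"
    by (intro continuous_at_imp_continuous_on ballI isCont_bessel_density) simp
qed

lemma integrable_linnik_density:
  assumes "is_linnik_density \<alpha> \<nu> p"
  shows "integrable lborel p"
proof (rule integrableI_nonneg)
  have m [measurable]: "p \<in> borel_measurable borel" and p: "prob_space (density lborel (\<lambda>x. ennreal (p x)))"
    using assms by (auto simp: is_linnik_density_def)
  show "p \<in> borel_measurable lborel" using m by simp
  show "AE x in lborel. 0 \<le> p x" using assms by (simp add: is_linnik_density_def)
  have "(\<integral>\<^sup>+x. ennreal (p x) \<partial>lborel) = emeasure (density lborel (\<lambda>x. ennreal (p x))) UNIV"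
    by (subst emeasure_density) auto
  also have "\<dots> = 1" using prob_space.emeasure_space_1[OF p] by simp
  finally show "(\<integral>\<^sup>+x. ennreal (p x) \<partial>lborel) < \<infinity>" by simp
qed

text \<open>Existence of one density, \<open>bessel_density\<close>, guarantees that the one picked
  by \<open>SOME\<close> has the defining properties; uniqueness at points of continuity then
  identifies the two away from the origin.\<close>

lemma linnik_density_2:
  fixes x :: "real ^ 'n::finite"
  assumes \<nu>: "\<nu> > 0" and x: "x \<noteq> 0"
  shows "linnik_density 2 \<nu> x = bessel_density \<nu> x"
proof -
  have L: "is_linnik_density 2 \<nu> (linnik_density 2 \<nu> :: real ^ 'n \<Rightarrow> real)"
    unfolding linnik_density_def by (rule someI[where P = "is_linnik_density 2 \<nu>", OF is_linnik_density_bessel_density[OF \<nu>]])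
  note B = is_linnik_density_bessel_density[OF \<nu>, where 'n = 'n]
  have "isCont (linnik_density 2 \<nu>) x"
    using L x by (simp add: is_linnik_density_def continuous_on_eq_continuous_at[of "UNIV - {0}"] open_Diff)
  then show ?thesis
    using density_eq_of_char_eq[OF integrable_linnik_density[OF L] _ integrable_linnik_density[OF B] isCont_bessel_density[OF x]]
      L B by (simp add: is_linnik_density_def)
qed

lemma linnik_radial_2:
  assumes \<nu>: "\<nu> > 0" and r: "r > 0"
  shows "linnik_radial TYPE('n::finite) 2 \<nu> r
    = bessel_integral (real CARD('n) / 2 - \<nu>) ((r / 2)\<^sup>2) / (Gamma \<nu> * (2 ^ CARD('n) * pi powr (real CARD('n) / 2)))"
proof -
  let ?c = "bessel_integral (real CARD('n) / 2 - \<nu>) ((r / 2)\<^sup>2) / (Gamma \<nu> * (2 ^ CARD('n) * pi powr (real CARD('n) / 2)))"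
  have "(4::real) powr (real CARD('n) / 2) = 2 ^ CARD('n)"
    using powr_powr[of 2 2 "real CARD('n) / 2"] by (simp add: powr_realpow)
  then have c4: "(4 * pi) powr (real CARD('n) / 2) = 2 ^ CARD('n) * pi powr (real CARD('n) / 2)"
    by (simp add: powr_mult)
  have *: "linnik_density 2 \<nu> x = ?c" if "norm x = r" for x :: "real ^ 'n"
    using that r by (subst linnik_density_2[OF \<nu>]) (auto simp: bessel_density_def c4 power_divide)
  \<comment> \<open>On an empty sphere every value would satisfy the description, so
    \<open>THE\<close> needs this witness.\<close>
  obtain x0 :: "real ^ 'n" where "norm x0 = r"
    using vector_choose_size[of r] r by auto
  then show ?thesis
    unfolding linnik_radial_def using * by (intro the_equality) auto
qed

section \<open>Translation of the Bessel formulas into series in r\<close>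

theorem proposition3p2:
  fixes n :: nat and \<nu> r :: real
  assumes n: "n = CARD('n::finite)" and \<nu>: "\<nu> > 0" and r: "r > 0"
  shows
    "(real n / 2 - \<nu> \<notin> \<int> \<longrightarrow>
       (let f = (\<lambda>j::nat.
              (r / 2) powr (2 * real j + 2 * \<nu> - real n)
                / (fact j * Gamma (real j + \<nu> - (real n - 2) / 2))
            - (r / 2) ^ (2 * j)
                / (fact j * Gamma (real j + (real n + 2) / 2 - \<nu>)))
        in summable f \<and>
           linnik_radial TYPE('n) 2 \<nu> r =
             1 / (2 ^ n * pi powr ((real n - 2) / 2) * Gamma \<nu> * sin (pi * (real n / 2 - \<nu>)))
             * (\<Sum>j. f j)))
     \<and>
     (\<forall>l::int. real n / 2 - \<nu> = real_of_int l \<longrightarrow>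
       (let g = (\<lambda>j::nat.
              (r / 2) powi (\<bar>l\<bar> - l + 2 * int j) / (fact j * fact (nat \<bar>l\<bar> + j))
              * (2 * ln (r / 2) - Digamma (real j + 1) - Digamma (real (nat \<bar>l\<bar> + j) + 1)))
        in summable g \<and>
           linnik_radial TYPE('n) 2 \<nu> r =
             1 / (2 ^ n * pi powr (real n / 2) * Gamma (real n / 2 - real_of_int l))
             * ((\<Sum>j<nat \<bar>l\<bar>. (- 1) ^ j * (fact (nat \<bar>l\<bar> - j - 1) / fact j)
                    * (r / 2) powi (2 * int j - \<bar>l\<bar> - l))
                + (- 1) powi (l + 1) * (\<Sum>j. g j))))"
proof (intro conjI impI allI)
  define x where "x = (r / 2)\<^sup>2"
  have x: "x > 0" using r by (simp add: x_def)
  define \<mu> where "\<mu> = real n / 2 - \<nu>"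
  have xpow: "(r / 2) ^ (2 * j) = x ^ j" for j by (simp add: x_def power_mult)
  have radial: "linnik_radial TYPE('n) 2 \<nu> r = bessel_integral \<mu> x / (Gamma \<nu> * (2 ^ n * pi powr (real n / 2)))"
    using linnik_radial_2[OF \<nu> r, where 'n = 'n] by (simp add: n x_def \<mu>_def)
  {
    assume nonint: "real n / 2 - \<nu> \<notin> \<int>"
    define f where "f = (\<lambda>j::nat.
              (r / 2) powr (2 * real j + 2 * \<nu> - real n)
                / (fact j * Gamma (real j + \<nu> - (real n - 2) / 2))
            - (r / 2) ^ (2 * j)
                / (fact j * Gamma (real j + (real n + 2) / 2 - \<nu>)))"
    have f_eq: "f j = x powr (- \<mu>) * (rGamma (real j + 1 + - \<mu>) / fact j * x ^ j) - rGamma (real j + 1 + \<mu>) / fact j * x ^ j" for j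
    proof -
      have "(r / 2) powr (2 * real j + 2 * \<nu> - real n) = ((r / 2) powr 2) powr (real j + - \<mu>)"
        unfolding powr_powr by (simp add: \<mu>_def algebra_simps)
      also have "\<dots> = x ^ j * x powr (- \<mu>)"
      proof -
        have "(r / 2) powr 2 = x" using r by (simp add: x_def)
        then show ?thesis using x by (simp only: powr_add powr_realpow)
      qed
      finally have "(r / 2) powr (2 * real j + 2 * \<nu> - real n) = x ^ j * x powr (- \<mu>)" .
      moreover have "real j + \<nu> - (real n - 2) / 2 = real j + 1 + - \<mu>"
        "real j + (real n + 2) / 2 - \<nu> = real j + 1 + \<mu>"
        by (simp_all add: \<mu>_def field_simps)
      moreover have "X * p / (k * G) - X / (k * G') = p * (inverse G / k * X) - inverse G' / k * X"
        for X p k G G' :: real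
        by (simp add: divide_inverse)
      ultimately show ?thesis
        unfolding f_def xpow by (simp only: rGamma_inverse_Gamma)
    qed
    have f_sums: "f sums (x powr (- \<mu>) * bessel_series (- \<mu>) x - bessel_series \<mu> x)"
      unfolding f_eq[abs_def] by (intro sums_diff sums_mult bessel_series_sums)
    \<comment> \<open>The factor pi split off here cancels the pi in
      \<open>bessel_combination\<close>, which explains the exponent (n - 2)/2.\<close>
    have "pi powr (real n / 2) = pi powr ((real n - 2) / 2) * pi"
      using powr_add[of pi "(real n - 2) / 2" 1] by (simp add: field_simps)
    then have f_val: "linnik_radial TYPE('n) 2 \<nu> r =
             1 / (2 ^ n * pi powr ((real n - 2) / 2) * Gamma \<nu> * sin (pi * (real n / 2 - \<nu>))) * (\<Sum>j. f j)"
      using bessel_integral_nonint[OF nonint[folded \<mu>_def] x] sums_unique[OF f_sums]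
      unfolding radial by (simp add: bessel_combination_def flip: \<mu>_def)
    show "let f = (\<lambda>j::nat.
              (r / 2) powr (2 * real j + 2 * \<nu> - real n)
                / (fact j * Gamma (real j + \<nu> - (real n - 2) / 2))
            - (r / 2) ^ (2 * j)
                / (fact j * Gamma (real j + (real n + 2) / 2 - \<nu>)))
        in summable f \<and>
           linnik_radial TYPE('n) 2 \<nu> r =
             1 / (2 ^ n * pi powr ((real n - 2) / 2) * Gamma \<nu> * sin (pi * (real n / 2 - \<nu>)))
             * (\<Sum>j. f j)"
      unfolding Let_def f_def[symmetric] by (rule conjI[OF sums_summable[OF f_sums] f_val])
  next
    fix l :: int
    assume l: "real n / 2 - \<nu> = real_of_int l"
    define m where "m = nat \<bar>l\<bar>"
    \<comment> \<open>The reflection factor: for l < 0 the integral at index -m is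
      \<open>x ^ m\<close> times the one at m. It also equals
      \<open>(r / 2) powi (\<bar>l\<bar> - l)\<close>, so both signs of l are handled
      together.\<close>
    define y where "y = (if l \<ge> 0 then 1 else x ^ m)"
    define g where "g = (\<lambda>j::nat.
              (r / 2) powi (\<bar>l\<bar> - l + 2 * int j) / (fact j * fact (nat \<bar>l\<bar> + j))
              * (2 * ln (r / 2) - Digamma (real j + 1) - Digamma (real (nat \<bar>l\<bar> + j) + 1)))"
    let ?h = "\<Sum>j<m. (- 1) ^ j * (fact (m - j - 1) / fact j) * (x ^ j / x ^ m)"
    have \<mu>: "\<mu> = of_int l" using l by (simp only: \<mu>_def)
    have F: "bessel_integral \<mu> x = y * bessel_integral (real m) x"
    proof (cases "l \<ge> 0")
      case True
      then have "\<mu> = real m" "y = 1" by (simp_all add: y_def m_def \<mu>)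
      then show ?thesis by (simp only: mult_1_left)
    next
      case False
      then have "\<mu> = - real m" by (simp add: m_def \<mu>)
      then show ?thesis
        using False x bessel_integral_reflect[OF x, of "real m"] by (simp add: y_def powr_realpow)
    qed
    have r0: "r / 2 \<noteq> 0" using r by simp
    have y_pow: "(r / 2) powi (\<bar>l\<bar> - l + 2 * int j) = y * x ^ j" for j
    proof -
      have "\<bar>l\<bar> - l + 2 * int j = int (if l \<ge> 0 then 2 * j else 2 * (m + j))" by (auto simp: m_def)
      then show ?thesis
        by (simp only: power_int_of_nat) (simp add: xpow y_def power_add)
    qed
    have y_pow': "(r / 2) powi (2 * int j - \<bar>l\<bar> - l) = y * (x ^ j / x ^ m)" for j
    proof -
      have e: "2 * int j - \<bar>l\<bar> - l = (\<bar>l\<bar> - l + 2 * int j) - int (2 * m)" by (auto simp: m_def)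
      have "(r / 2) powi (2 * int j - \<bar>l\<bar> - l) = (r / 2) powi (\<bar>l\<bar> - l + 2 * int j) / (r / 2) powi int (2 * m)"
        unfolding e by (rule power_int_diff) (rule disjI1[OF r0])
      then show ?thesis
        by (simp only: power_int_of_nat y_pow xpow times_divide_eq_right)
    qed
    have "ln x = 2 * ln (r / 2)"
      using r by (simp add: x_def ln_realpow)
    then have g_eq: "g j = y * (x ^ j / (fact j * fact (m + j)) * (ln x - Digamma (real j + 1) - Digamma (real (m + j) + 1)))" for j
      unfolding g_def y_pow m_def[symmetric] by simp
    have g_sums: "g sums (y * ((- 1) ^ (m + 1) * (bessel_integral (real m) x - ?h)))"
      unfolding g_eq[abs_def] by (intro sums_mult bessel_integral_nat x)
    \<comment> \<open>For negative l the exponent is 1 - m, which has the same parity as m +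
      1.\<close>
    have sgn: "(- 1 :: real) powi (l + 1) = (- 1) ^ (m + 1)"
    proof (cases "l \<ge> 0")
      case True
      then have "l + 1 = int (m + 1)" by (simp add: m_def)
      then show ?thesis by (simp only: power_int_of_nat)
    next
      case False
      then have "l + 1 = - int m + 1" by (simp add: m_def)
      then show ?thesis by (simp add: power_int_add power_int_minus minus_one_power_iff)
    qed
    have "(\<Sum>j<m. (- 1) ^ j * (fact (m - j - 1) / fact j) * (r / 2) powi (2 * int j - \<bar>l\<bar> - l)) = y * ?h"
      unfolding y_pow' sum_distrib_left by (intro sum.cong refl) (simp add: mult_ac)
    then have "(\<Sum>j<m. (- 1) ^ j * (fact (m - j - 1) / fact j) * (r / 2) powi (2 * int j - \<bar>l\<bar> - l))
        + (- 1) powi (l + 1) * (\<Sum>j. g j) = bessel_integral \<mu> x"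
      unfolding sgn sums_unique[OF g_sums, symmetric] F
      by (simp add: minus_one_power_iff algebra_simps)
    moreover have "real n / 2 - real_of_int l = \<nu>" using l by simp
    ultimately have g_val: "linnik_radial TYPE('n) 2 \<nu> r =
             1 / (2 ^ n * pi powr (real n / 2) * Gamma (real n / 2 - real_of_int l))
             * ((\<Sum>j<m. (- 1) ^ j * (fact (m - j - 1) / fact j)
                    * (r / 2) powi (2 * int j - \<bar>l\<bar> - l))
                + (- 1) powi (l + 1) * (\<Sum>j. g j))"
      unfolding radial by (simp add: mult_ac)
    show "let g = (\<lambda>j::nat.
              (r / 2) powi (\<bar>l\<bar> - l + 2 * int j) / (fact j * fact (nat \<bar>l\<bar> + j))
              * (2 * ln (r / 2) - Digamma (real j + 1) - Digamma (real (nat \<bar>l\<bar> + j) + 1)))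
        in summable g \<and>
           linnik_radial TYPE('n) 2 \<nu> r =
             1 / (2 ^ n * pi powr (real n / 2) * Gamma (real n / 2 - real_of_int l))
             * ((\<Sum>j<nat \<bar>l\<bar>. (- 1) ^ j * (fact (nat \<bar>l\<bar> - j - 1) / fact j)
                    * (r / 2) powi (2 * int j - \<bar>l\<bar> - l))
                + (- 1) powi (l + 1) * (\<Sum>j. g j))"
      unfolding Let_def unfolding g_def[symmetric] unfolding m_def[symmetric] by (rule conjI[OF sums_summable[OF g_sums] g_val])
  }
qed

end
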